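(* Define $\mathcal{F}:\Omega^V\to\mathbb{H}(\mathbb{X})^V$ by $\mathcal{F}(\omega_1,\dots,\omega_V)=(\mathcal{F}(\omega_1),\dots,\mathcal{F}(\omega_V))$. Then $$\mathcal{F}(\eta^a(\omega))=f^a(\mathcal{F}(\omega))\qquad\text{for all }a\in\mathcal{A},\ \omega\in\Omega^V .$$ Also $$\mathcal{F}(\Omega_V)=\mathfrak{H}_V\quad\text{and}\quad \mathcal{F}(\Omega_{V,1})=\mathfrak{H}_{V,1}.$$ Similarly, when $\mathcal{P}^{a}=\dfrac{P_{n_1}P_{n_2}\cdots P_{n_V}}{V^{MV}}$ for every $a\in\mathcal{A}$, we have $$\mathcal{F}(\mu_V)=\mathfrak{P}_V\quad\text{and}\quad\mathcal{F}(\rho_V)=\mathfrak{P}_{V,1},$$ where $\mathcal{F}$ of a measure denotes the push-forward.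
   Context: IFS. An IFS (with probabilities) on a compact metric space $Y$ is a finite family of contraction maps $g_a:Y\to Y$ together with probabilities $p_a\ge 0$, $\sum_a p_a=1$. Its set attractor is the unique non-empty compact $A\subset Y$ with $A=\bigcup_a g_a(A)$; its measure attractor is the unique Borel probability measure $\mu$ on $Y$ with $\mu=\sum_a p_a\, g_a(\mu)$, where $g(\mu)=\mu\circ g^{-1}$. SuperIFS. $(\mathbb{X},d)$ is a compact metric space; $M,N,V$ are positive integers with $M\ge2$. For $n\in\{1,\dots,N\}$, $m\in\{1,\dots,M\}$, $f_m^n:\mathbb{X}\to\mathbb{X}$ is Lipschitz with constant $l$, where $0\le l<1$ is fixed. $P_1,\dots,P_N>0$ with $\sum_nP_n=1$. Code trees. $T$ is the set of all finite sequences over $\{1,\dots,M\}$, including the empty sequence $\emptyset$; $|i|$ is the length of $i\in T$ and $ij$ denotes concatenation. A code tree is a function $\tau:T\to\{1,\dots,N\}$; $\Omega$ is the set of all code trees with metric $d_\Omega(\omega,\varkappa)=M^{-k}$ for $\omega\ne\varkappa$, where $k$ is the least integer such that $\omega(i)\neq\varkappa(i)$ for some $i\in T$ with $|i|=k$. $\Omega^V$ is the $V$-fold product with the maximum metric. The map $\mathcal{F}:\Omega\to\mathbb{H}(\mathbb{X})$. $\mathbb{H}=\mathbb{H}(\mathbb{X})$ is the set of non-empty compact subsets of $\mathbb{X}$ with the Hausdorff metric. For $\sigma\in\Omega$, $$\mathcal{F}(\sigma)=\lim_{k\to\infty}\ \bigcup_{i=i_1\cdots i_k\in T}f_{i_1}^{\sigma(\emptyset)}\circ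 f_{i_2}^{\sigma(i_1)}\circ\cdots\circ f_{i_k}^{\sigma(i_1i_2\cdots i_{k-1})}(K),$$ the limit existing in the Hausdorff metric and being independent of $K\in\mathbb{H}(\mathbb{X})$; $\mathcal{F}$ is continuous. The IFSs $\Phi$ and $\mathcal{F}_V$. $\mathcal{A}=\{\{1,\dots,N\}\times\{1,\dots,V\}^M\}^V$; write $a=(a_1,\dots,a_V)\in\mathcal{A}$ with $a_v=(n_v;v_{v,1},\dots,v_{v,M})$. $\{\mathcal{P}^a\}_{a\in\mathcal{A}}$ are probabilities ($\mathcal P^a\ge0$, $\sum_a\mathcal P^a=1$). Define $\xi_n:\Omega^M\to\Omega$ by $(\xi_n(\omega))(\emptyset)=n$, $(\xi_n(\omega))(mi)=\omega_m(i)$ for $i\in T$, $m\in\{1,\dots,M\}$. For $a\in\mathcal{A}$, $\eta^a:\Omega^V\to\Omega^V$ is the map whose $v$-th component at $(\omega_1,\dots,\omega_V)$ is $\xi_{n_v}(\omega_{v_{v,1}},\dots,\omega_{v_{v,M}})$, and $f^a:\mathbb{H}^V\to\mathbb{H}^V$ is the map whose $v$-th component at $(K_1,\dots,K_V)$ is $\bigcup_{m=1}^M f_m^{n_v}(K_{v_{v,m}})$. Both $\Phi=\{\Omega^V;\eta^a,\mathcal{P}^a,a\in\mathcal{A}\}$ and $\mathcal{F}_V=\{\mathbb{H}^V;f^a,\mathcal{P}^a,a\in\mathcal{A}\}$ (maximum metric on $\mathbb{H}^V$) are IFSs of contractions. $\Omega_V,\mu_V$ are the set and measure attractors of $\Phi$;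 $\mathfrak{H}_V,\mathfrak{P}_V$ are those of $\mathcal{F}_V$. $\Omega_{V,1}$ and $\mathfrak{H}_{V,1}$ are the sets of first components of elements of $\Omega_V$ and $\mathfrak{H}_V$. The marginals are $\rho_V(B)=\mu_V(B\times\Omega\times\cdots\times\Omega)$ for Borel $B\subset\Omega$ and $\mathfrak{P}_{V,1}(B)=\mathfrak{P}_V(B\times\mathbb{H}\times\cdots\times\mathbb{H})$ for Borel $B\subset\mathbb{H}$. *)

theory Defs
  imports "HOL-Probability.Probability"
begin

section \<open>Metric spaces given by a carrier and a distance\<close>

definition borel_on :: "'a set \<Rightarrow> ('a \<Rightarrow> 'a \<Rightarrow> real) \<Rightarrow> 'a measure" where
  "borel_on S d = sigma S {U. openin (Metric_space.mtopology S d) U}"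

definition power_carrier :: "'a set \<Rightarrow> ('v \<Rightarrow> 'a) set" where
  "power_carrier S = {x. \<forall>v. x v \<in> S}"

definition max_dist :: "('a \<Rightarrow> 'a \<Rightarrow> real) \<Rightarrow> ('v::finite \<Rightarrow> 'a) \<Rightarrow> ('v \<Rightarrow> 'a) \<Rightarrow> real" where
  "max_dist d x y = Max (range (\<lambda>v. d (x v) (y v)))"

lemma Metric_space_power:
  assumes "Metric_space S d"
  shows "Metric_space (power_carrier S) (max_dist d :: ('v::finite \<Rightarrow> 'a) \<Rightarrow> _)"
proof -
  interpret Metric_space S d by fact
  have ge: "d (x v) (y v) \<le> max_dist d x y" for x y :: "'v \<Rightarrow> 'a" and v
    unfolding max_dist_def by (intro Max_ge) auto
  have le: "max_dist d x y \<le> c \<longleftrightarrow> (\<forall>v. d (x v) (y v) \<le> c)" for x y :: "'v \<Rightarrow> 'a" and c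
    unfolding max_dist_def by (subst Max_le_iff) auto
  have nn: "0 \<le> max_dist d x y" for x y :: "'v \<Rightarrow> 'a"
    using ge[of x undefined y] nonneg order_trans by blast
  show ?thesis
  proof
    fix x y :: "'v \<Rightarrow> 'a"
    show "0 \<le> max_dist d x y" by (rule nn)
    show "max_dist d x y = max_dist d y x"
      by (simp add: max_dist_def commute)
    assume x: "x \<in> power_carrier S" and y: "y \<in> power_carrier S"
    have "max_dist d x y = 0 \<longleftrightarrow> (\<forall>v. d (x v) (y v) \<le> 0)"
      using le[of x y 0] nn[of x y] by auto
    also have "\<dots> \<longleftrightarrow> (\<forall>v. x v = y v)"
    proof (intro iff_allI)
      fix v
      have "d (x v) (y v) \<le> 0 \<longleftrightarrow> d (x v) (y v) = 0"
        using nonneg[of "x v" "y v"] by linarith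
      also have "\<dots> \<longleftrightarrow> x v = y v"
        using x y zero by (simp add: power_carrier_def)
      finally show "d (x v) (y v) \<le> 0 \<longleftrightarrow> x v = y v" .
    qed
    finally show "max_dist d x y = 0 \<longleftrightarrow> x = y" by auto
    fix z :: "'v \<Rightarrow> 'a" assume z: "z \<in> power_carrier S"
    show "max_dist d x z \<le> max_dist d x y + max_dist d y z"
      unfolding le
    proof
      fix v
      have "d (x v) (z v) \<le> d (x v) (y v) + d (y v) (z v)"
        using x y z by (intro triangle) (auto simp: power_carrier_def)
      then show "d (x v) (z v) \<le> max_dist d x y + max_dist d y z"
        using ge[of x v y] ge[of y v z] by linarith
    qed
  qed
qed

section \<open>Attractors of iterated function systems\<close>

definition set_attractor ::
  "'a set \<Rightarrow> ('a \<Rightarrow> 'a \<Rightarrow> real) \<Rightarrow> ('i::finite \<Rightarrow> 'a \<Rightarrow> 'a) \<Rightarrow> 'a set" where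
  "set_attractor S d g =
     (THE A. A \<noteq> {} \<and> compactin (Metric_space.mtopology S d) A \<and> A = (\<Union>i. g i ` A))"

definition measure_attractor ::
  "'a set \<Rightarrow> ('a \<Rightarrow> 'a \<Rightarrow> real) \<Rightarrow> ('i::finite \<Rightarrow> 'a \<Rightarrow> 'a) \<Rightarrow> ('i \<Rightarrow> real) \<Rightarrow> 'a measure" where
  "measure_attractor S d g p =
     (THE \<mu>. sets \<mu> = sets (borel_on S d) \<and> prob_space \<mu> \<and>
        (\<forall>B\<in>sets (borel_on S d).
           measure \<mu> B = (\<Sum>i\<in>UNIV. p i * measure (distr \<mu> (borel_on S d) (g i)) B)))"

section \<open>The Hausdorff metric on non-empty compact sets\<close>

definition nonempty_compacts :: "'x::metric_space set set" where
  "nonempty_compacts = {K. K \<noteq> {} \<and> compact K}"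

text \<open>The guard makes the distance non-negative on all pairs of sets, as the locale \<open>Metric_space\<close>
  requires; on \<open>nonempty_compacts\<close>, the space actually used, it has no effect.\<close>

definition hausdorff_dist :: "'x::metric_space set \<Rightarrow> 'x set \<Rightarrow> real" where
  "hausdorff_dist A B =
     (if A \<in> nonempty_compacts \<and> B \<in> nonempty_compacts
      then max (SUP a\<in>A. infdist a B) (SUP b\<in>B. infdist b A) else 0)"

lemma hausdorff_dist_le_iff:
  assumes "A \<in> nonempty_compacts" "B \<in> nonempty_compacts"
  shows "hausdorff_dist A B \<le> c \<longleftrightarrow> (\<forall>a\<in>A. infdist a B \<le> c) \<and> (\<forall>b\<in>B. infdist b A \<le> c)"
proof -
  have "bdd_above ((\<lambda>a. infdist a D) ` C)" if "compact C" for C D :: "'a set"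
    by (intro bounded_imp_bdd_above compact_imp_bounded compact_continuous_image
        continuous_intros that)
  with assms show ?thesis
    by (auto simp: hausdorff_dist_def nonempty_compacts_def cSUP_le_iff)
qed

lemma Metric_space_hausdorff:
  "Metric_space (nonempty_compacts :: 'x::metric_space set set) hausdorff_dist"
proof
  note le = hausdorff_dist_le_iff
  fix A B :: "'x set"
  have inf_le: "infdist a B \<le> hausdorff_dist A B" "infdist b A \<le> hausdorff_dist A B"
    if "A \<in> nonempty_compacts" "B \<in> nonempty_compacts" "a \<in> A" "b \<in> B" for A B :: "'x set" and a b
    using that le[of A B "hausdorff_dist A B"] by auto
  show nn: "0 \<le> hausdorff_dist A B"
  proof (cases "A \<in> nonempty_compacts \<and> B \<in> nonempty_compacts")
    case True
    then obtain a b where "a \<in> A" "b \<in> B" by (auto simp: nonempty_compacts_def)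
    with True inf_le[of A B a b] infdist_nonneg[of a B] show ?thesis by linarith
  qed (auto simp: hausdorff_dist_def)
  show "hausdorff_dist A B = hausdorff_dist B A"
    by (auto simp: hausdorff_dist_def max.commute)
  assume A: "A \<in> nonempty_compacts" and B: "B \<in> nonempty_compacts"
  have z: "infdist x C \<le> 0 \<longleftrightarrow> x \<in> C" if "C \<in> nonempty_compacts" for x and C :: "'x set"
    using that in_closed_iff_infdist_zero[of C x] infdist_nonneg[of x C]
    by (auto simp: nonempty_compacts_def compact_imp_closed)
  show "hausdorff_dist A B = 0 \<longleftrightarrow> A = B"
  proof -
    have "hausdorff_dist A B = 0 \<longleftrightarrow> hausdorff_dist A B \<le> 0" using nn by linarith
    also have "\<dots> \<longleftrightarrow> (\<forall>a\<in>A. a \<in> B) \<and> (\<forall>b\<in>B. b \<in> A)"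
      unfolding le[OF A B] z[OF A] z[OF B] ..
    also have "\<dots> \<longleftrightarrow> A = B" by blast
    finally show ?thesis .
  qed
  fix C :: "'x set" assume C: "C \<in> nonempty_compacts"
  have step: "infdist x E \<le> infdist x D + hausdorff_dist D E"
    if D: "D \<in> nonempty_compacts" and E: "E \<in> nonempty_compacts" for x and D E :: "'x set"
  proof -
    from D obtain y where y: "y \<in> D" "infdist x D = dist x y"
    proof -
      have "compact D" "D \<noteq> {}" "continuous_on D (dist x)"
        using D by (auto simp: nonempty_compacts_def intro!: continuous_intros)
      from continuous_attains_inf[OF this] obtain y
        where "y \<in> D" "\<forall>w\<in>D. dist x y \<le> dist x w" by blast
      moreover from this have "infdist x D = dist x y"
        using \<open>D \<noteq> {}\<close> infdist_le[of y D x]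
        by (intro antisym) (auto simp: infdist_notempty intro!: cINF_greatest)
      ultimately show ?thesis using that by blast
    qed
    obtain e where "e \<in> E" using E by (auto simp: nonempty_compacts_def)
    have "infdist x E \<le> infdist y E + dist x y" by (rule infdist_triangle)
    also have "infdist y E \<le> hausdorff_dist D E" using inf_le(1)[OF D E y(1) \<open>e \<in> E\<close>] .
    finally show ?thesis using y by simp
  qed
  have comm: "hausdorff_dist D E = hausdorff_dist E D" for D E :: "'x set"
    by (auto simp: hausdorff_dist_def max.commute)
  have pt: "infdist a E \<le> hausdorff_dist D E" if "D \<in> nonempty_compacts" "E \<in> nonempty_compacts" "a \<in> D"
    for a and D E :: "'x set"
    using le[of D E "hausdorff_dist D E"] that by auto
  show "hausdorff_dist A C \<le> hausdorff_dist A B + hausdorff_dist B C"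
    unfolding le[OF A C]
  proof (intro conjI ballI)
    fix a assume "a \<in> A"
    then show "infdist a C \<le> hausdorff_dist A B + hausdorff_dist B C"
      using step[OF B C, of a] pt[OF A B, of a] by linarith
  next
    fix c assume "c \<in> C"
    then show "infdist c A \<le> hausdorff_dist A B + hausdorff_dist B C"
      using step[OF B A, of c] pt[OF C B, of c] comm[of A B] comm[of B C] by linarith
  qed
qed

section \<open>Code trees\<close>

text \<open>The alphabets \<open>{1..M}\<close>, \<open>{1..N}\<close>, \<open>{1..V}\<close> are the finite types \<open>'m\<close>, \<open>'n\<close>, \<open>'v\<close>;
  finite sequences over \<open>{1..M}\<close> are lists, with \<open>[]\<close> as the root.\<close>

type_synonym ('m, 'n) code_tree = "'m list \<Rightarrow> 'n"

definition code_tree_dist ::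
  "('m::finite, 'n) code_tree \<Rightarrow> ('m, 'n) code_tree \<Rightarrow> real" where
  "code_tree_dist \<omega> \<kappa> =
     (if \<omega> = \<kappa> then 0
      else 1 / real CARD('m) ^ (LEAST k. \<exists>i. length i = k \<and> \<omega> i \<noteq> \<kappa> i))"

lemma Metric_space_code_tree:
  "Metric_space UNIV (code_tree_dist :: ('m::finite, 'n) code_tree \<Rightarrow> _)"
proof
  let ?L = "\<lambda>x y :: ('m, 'n) code_tree. LEAST k. \<exists>i. length i = k \<and> x i \<noteq> y i"
  fix x y z :: "('m, 'n) code_tree"
  have M: "1 \<le> real CARD('m)" by (simp add: Suc_leI)
  show nn: "0 \<le> code_tree_dist x y" for x y :: "('m, 'n) code_tree"
    by (simp add: code_tree_dist_def)
  show "code_tree_dist x y = code_tree_dist y x"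
    by (simp add: code_tree_dist_def eq_commute[of x y] eq_commute[of "x _" "y _"])
  show "code_tree_dist x y = 0 \<longleftrightarrow> x = y"
    by (simp add: code_tree_dist_def)
  have ge: "1 / real CARD('m) ^ length i \<le> code_tree_dist x y"
    if "x i \<noteq> y i" for i and x y :: "('m, 'n) code_tree"
  proof -
    have "?L x y \<le> length i" using that by (auto intro: Least_le)
    then have "real CARD('m) ^ ?L x y \<le> real CARD('m) ^ length i"
      using M by (rule power_increasing)
    then show ?thesis using that by (auto simp: code_tree_dist_def intro: divide_left_mono)
  qed
  show "code_tree_dist x z \<le> code_tree_dist x y + code_tree_dist y z"
  proof (cases "x = z")
    case True
    then show ?thesis using nn[of x y] nn[of y z] by (simp add: code_tree_dist_def)
  next
    case False
    then have "\<exists>k i. length i = k \<and> x i \<noteq> z i" by auto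
    from LeastI_ex[OF this] obtain i where i: "length i = ?L x z" "x i \<noteq> z i" by blast
    then have eq: "code_tree_dist x z = 1 / real CARD('m) ^ length i"
      using False by (simp add: code_tree_dist_def)
    from i consider "x i \<noteq> y i" | "y i \<noteq> z i" by metis
    then show ?thesis
      using ge[of x i y] ge[of y i z] nn[of x y] nn[of y z] unfolding eq by cases linarith+
  qed
qed

text \<open>Below, \<open>f n m\<close> is the \<open>m\<close>-th map of the \<open>n\<close>-th function system.  For \<open>i = [i\<^sub>1, \<dots>, i\<^sub>k]\<close>,
  \<open>branch_map f \<sigma> i\<close> is the composition of the maps \<open>f (\<sigma> [i\<^sub>1, \<dots>, i\<^sub>j]) i\<^sub>j\<^sub>+\<^sub>1\<close> for \<open>j = 0, \<dots>, k - 1\<close>,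
  the one with \<open>j = 0\<close> outermost.\<close>

definition branch_map ::
  "('n \<Rightarrow> 'm \<Rightarrow> 'x \<Rightarrow> 'x) \<Rightarrow> ('m, 'n) code_tree \<Rightarrow> 'm list \<Rightarrow> 'x \<Rightarrow> 'x" where
  "branch_map f \<sigma> i = foldr (\<circ>) (map (\<lambda>j. f (\<sigma> (take j i)) (i ! j)) [0..<length i]) id"

definition tree_set ::
  "('n \<Rightarrow> 'm \<Rightarrow> 'x \<Rightarrow> 'x) \<Rightarrow> ('m, 'n) code_tree \<Rightarrow> 'x::metric_space set" where
  "tree_set f \<sigma> =
     (THE L. \<forall>K\<in>nonempty_compacts.
        limitin (Metric_space.mtopology nonempty_compacts hausdorff_dist)
          (\<lambda>k. \<Union>i\<in>{i. length i = k}. branch_map f \<sigma> i ` K) L sequentially)"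

definition tree_tuple ::
  "('n \<Rightarrow> 'm \<Rightarrow> 'x \<Rightarrow> 'x) \<Rightarrow> ('v \<Rightarrow> ('m, 'n) code_tree) \<Rightarrow> 'v \<Rightarrow> 'x::metric_space set" where
  "tree_tuple f \<omega> = (\<lambda>v. tree_set f (\<omega> v))"

section \<open>The superIFS on tuples of code trees and on tuples of compact sets\<close>

text \<open>\<open>a v = (n\<^sub>v, w)\<close> where \<open>w m\<close> is the component used as \<open>m\<close>-th argument.\<close>

type_synonym ('v, 'n, 'm) super_index = "'v \<Rightarrow> 'n \<times> ('m \<Rightarrow> 'v)"

fun graft :: "'n \<Rightarrow> ('m \<Rightarrow> ('m, 'n) code_tree) \<Rightarrow> ('m, 'n) code_tree" where
  "graft n \<omega> [] = n"
| "graft n \<omega> (m # i) = \<omega> m i"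

definition tree_step ::
  "('v, 'n, 'm) super_index \<Rightarrow> ('v \<Rightarrow> ('m, 'n) code_tree) \<Rightarrow> 'v \<Rightarrow> ('m, 'n) code_tree" where
  "tree_step a \<omega> = (\<lambda>v. graft (fst (a v)) (\<lambda>m. \<omega> (snd (a v) m)))"

definition set_step ::
  "('n \<Rightarrow> 'm \<Rightarrow> 'x \<Rightarrow> 'x) \<Rightarrow> ('v, 'n, 'm) super_index \<Rightarrow> ('v \<Rightarrow> 'x set) \<Rightarrow> 'v \<Rightarrow> 'x set" where
  "set_step f a K = (\<lambda>v. \<Union>m. f (fst (a v)) m ` K (snd (a v) m))"

definition tree_attractor :: "('v::finite \<Rightarrow> ('m::finite, 'n::finite) code_tree) set" where
  "tree_attractor =
     set_attractor (power_carrier UNIV) (max_dist code_tree_dist)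
       (tree_step :: ('v, 'n, 'm) super_index \<Rightarrow> _)"

definition tree_measure ::
  "(('v::finite, 'n::finite, 'm::finite) super_index \<Rightarrow> real)
   \<Rightarrow> ('v \<Rightarrow> ('m, 'n) code_tree) measure" where
  "tree_measure p =
     measure_attractor (power_carrier UNIV) (max_dist code_tree_dist) tree_step p"

definition super_attractor ::
  "('n::finite \<Rightarrow> 'm::finite \<Rightarrow> 'x \<Rightarrow> 'x) \<Rightarrow> ('v::finite \<Rightarrow> 'x::metric_space set) set" where
  "super_attractor f =
     set_attractor (power_carrier nonempty_compacts) (max_dist hausdorff_dist)
       (set_step f :: ('v, 'n, 'm) super_index \<Rightarrow> _)"

definition super_measure ::
  "('n::finite \<Rightarrow> 'm::finite \<Rightarrow> 'x \<Rightarrow> 'x) \<Rightarrow> (('v::finite, 'n, 'm) super_index \<Rightarrow> real)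
   \<Rightarrow> ('v \<Rightarrow> 'x::metric_space set) measure" where
  "super_measure f p =
     measure_attractor (power_carrier nonempty_compacts) (max_dist hausdorff_dist) (set_step f) p"

end

(* The coding map from streams of indices onto Omega_V is explicit: the entries of the trees at
   depth k are read off from the first k + 1 letters.  Its image is the set attractor of Phi, and it
   carries the Bernoulli measure to the measure attractor.  The map F unfolds one level at a time,
   F(sigma) = (UN m. f_m F(sigma_m)), with sigma_m the subtree at m; this is the conjugacy with the
   IFS on compact sets, and since all maps contract it also makes F continuous.  Hence F carries
   attractors of Phi to compact invariant sets and invariant measures of F_V, so that for F_V only
   uniqueness is needed, never completeness of the hyperspace. *)

theory Submission
  imports Defs
begin

section \<open>Uniqueness of attractors\<close>

text \<open>\<open>set_attractor\<close>, \<open>measure_attractor\<close> and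
  \<open>tree_set\<close> are definite descriptions, so nothing can be said about them before both a
  witness and its uniqueness are known. Uniqueness is therefore proved in general form, for
  contractions with a common ratio below 1 on an arbitrary metric space, bounded in the case of
  measures. For measures it avoids integrals and any metric between measures: the mass that one
  solution gives to a closed set is bounded by the mass that the other gives to its small
  neighbourhoods, and the roles are then exchanged. For \<open>tree_set\<close> the witness is an
  intersection of nested compact sets, so that compactness of the base space alone supplies the
  limit. On the stream side, agreement on the first k letters serves both the product topology, for
  compactness, and the product sigma-algebra, for the Bernoulli measure.\<close>

lemma max_dist_le_iff:
  fixes x y :: "'v::finite \<Rightarrow> 'a"
  shows "max_dist d x y \<le> c \<longleftrightarrow> (\<forall>v. d (x v) (y v) \<le> c)"
  unfolding max_dist_def by (subst Max_le_iff) auto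

lemma max_dist_ge:
  fixes x y :: "'v::finite \<Rightarrow> 'a"
  shows "d (x v) (y v) \<le> max_dist d x y"
  using max_dist_le_iff[of d x y "max_dist d x y"] by simp

lemma Lipschitz_continuous_map_mtopology:
  assumes S: "Metric_space S d" and T: "Metric_space T e"
    and h: "h \<in> S \<rightarrow> T" and c: "\<And>x y. x \<in> S \<Longrightarrow> y \<in> S \<Longrightarrow> e (h x) (h y) \<le> c * d x y"
  shows "continuous_map (Metric_space.mtopology S d) (Metric_space.mtopology T e) h"
proof -
  interpret Metric_space S d by fact
  show ?thesis
    unfolding metric_continuous_map[OF T]
  proof (intro conjI ballI allI impI)
    fix x \<epsilon> :: real and a assume a: "a \<in> S" and \<epsilon>: "0 < \<epsilon>"
    show "\<exists>\<delta>>0. \<forall>y. y \<in> S \<and> d a y < \<delta> \<longrightarrow> e (h a) (h y) < \<epsilon>"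
    \<comment> \<open>The constant \<open>c\<close> carries no sign condition;
      \<open>\<bar>c\<bar> + 1\<close> dominates it and is positive, so division is safe.\<close>
    proof (intro exI[of _ "\<epsilon> / (\<bar>c\<bar> + 1)"] conjI allI impI)
      fix y assume y: "y \<in> S \<and> d a y < \<epsilon> / (\<bar>c\<bar> + 1)"
      have "e (h a) (h y) \<le> c * d a y" using c a y by blast
      also have "\<dots> \<le> (\<bar>c\<bar> + 1) * d a y" by (intro mult_right_mono nonneg) auto
      also have "\<dots> < \<epsilon>" using y by (simp add: field_simps)
      finally show "e (h a) (h y) < \<epsilon>" .
    qed (use \<epsilon> in auto)
  qed (use h in auto)
qed

section \<open>Compact invariant sets of contractions\<close>

text \<open>Every point of \<open>A\<close> is some \<open>g i x\<close> with \<open>x\<close> again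
  in \<open>A\<close>. Going back k times and replacing the k-th ancestor by a point of
  \<open>B\<close> yields a point of \<open>B\<close> at distance at most \<open>c ^ k * D\<close>.
  Since \<open>B\<close> is closed, \<open>A\<close> cannot leave it. Uniqueness of the attractor is
  this inclusion used in both directions.\<close>

lemma (in Metric_space) invariant_compact_subset:
  fixes g :: "'i \<Rightarrow> 'a \<Rightarrow> 'a"
  assumes A: "compactin mtopology A" "A = (\<Union>i. g i ` A)"
    and B: "compactin mtopology B" "B \<noteq> {}" "B = (\<Union>i. g i ` B)"
    and c: "0 \<le> c" "c < 1" and g: "\<And>i x y. x \<in> M \<Longrightarrow> y \<in> M \<Longrightarrow> d (g i x) (g i y) \<le> c * d x y"
  shows "A \<subseteq> B"
proof -
  have AM: "A \<subseteq> M" and BM: "B \<subseteq> M"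
    using A(1) B(1) compactin_subset_topspace by fastforce+
  have "mbounded (A \<union> B)"
    using A(1) B(1) by (intro compactin_imp_mbounded compactin_Un)
  then obtain D where D: "\<And>x y. x \<in> A \<Longrightarrow> y \<in> B \<Longrightarrow> d x y \<le> D"
    unfolding mbounded_alt by blast
  have near: "\<forall>a\<in>A. \<exists>b\<in>B. d a b \<le> c ^ k * D" for k
  proof (induction k)
    case 0
    then show ?case using D B(2) by auto
  next
    case (Suc k)
    show ?case
    proof
      fix a assume "a \<in> A"
      then obtain i x where x: "x \<in> A" "a = g i x" using A(2) by blast
      with Suc obtain b where b: "b \<in> B" "d x b \<le> c ^ k * D" by blast
      have "d a (g i b) \<le> c * d x b" unfolding x(2) using x b AM BM by (intro g) auto
      also have "\<dots> \<le> c ^ Suc k * D" using mult_left_mono[OF b(2) c(1)] by (simp add: mult.assoc)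
      finally show "\<exists>b\<in>B. d a b \<le> c ^ Suc k * D" using b(1) B(3) by blast
    qed
  qed
  have "A \<subseteq> mtopology closure_of B"
    unfolding metric_closure_of
  proof (clarify, intro conjI allI impI)
    fix a and r :: real assume a: "a \<in> A" and r: "0 < r"
    have "(\<lambda>k. c ^ k * D) \<longlonglongrightarrow> 0 * D" using c by (intro tendsto_intros LIMSEQ_power_zero) auto
    then have "\<forall>\<^sub>F k in sequentially. c ^ k * D < r" using r by (intro order_tendstoD) auto
    then obtain k where "c ^ k * D < r" by (auto simp: eventually_sequentially)
    with near[of k] a obtain b where "b \<in> B" "d a b < r" by force
    then show "\<exists>y\<in>B. y \<in> mball a r" using a AM BM by auto
  qed (use AM in auto)
  also have "mtopology closure_of B = B"
    by (intro closure_of_closedin compactin_imp_closedin Hausdorff_space_mtopology B)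
  finally show ?thesis .
qed

lemma set_attractor_eqI:
  assumes S: "Metric_space S d"
    and A: "A \<noteq> {}" "compactin (Metric_space.mtopology S d) A" "A = (\<Union>i. g i ` A)"
    and c: "0 \<le> c" "c < 1" and g: "\<And>i x y. x \<in> S \<Longrightarrow> y \<in> S \<Longrightarrow> d (g i x) (g i y) \<le> c * d x y"
  shows "set_attractor S d g = A"
  unfolding set_attractor_def
proof (rule the_equality)
  fix B assume B: "B \<noteq> {} \<and> compactin (Metric_space.mtopology S d) B \<and> B = (\<Union>i. g i ` B)"
  show "B = A"
    using Metric_space.invariant_compact_subset[OF S, of A g B c]
      Metric_space.invariant_compact_subset[OF S, of B g A c] A B c g by blast
qed (use A in blast)

section \<open>Borel sets of a metric carrier and measurability of continuous maps\<close>

lemma (in Metric_space) openin_mtopology_subset: "openin mtopology U \<Longrightarrow> U \<subseteq> M"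
  using openin_subset by fastforce

lemma (in Metric_space) space_borel_on [simp]: "space (borel_on M d) = M"
  unfolding borel_on_def using openin_mtopology_subset by (intro space_measure_of) blast

lemma (in Metric_space) sets_borel_on: "sets (borel_on M d) = sigma_sets M {U. openin mtopology U}"
  unfolding borel_on_def
  using openin_mtopology_subset by (intro sets_measure_of) blast

lemma measurable_borel_on:
  assumes S: "Metric_space S d" and T: "Metric_space T e"
    and h: "continuous_map (Metric_space.mtopology S d) (Metric_space.mtopology T e) h"
    and \<mu>: "sets \<mu> = sets (borel_on S d)"
  shows "h \<in> measurable \<mu> (borel_on T e)"
proof -
  interpret S: Metric_space S d by fact
  interpret T: Metric_space T e by fact
  have "h \<in> measurable (borel_on S d) (borel_on T e)"
    unfolding borel_on_def[of T e]
  proof (rule measurable_measure_of)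
    show "{U. openin T.mtopology U} \<subseteq> Pow T" using T.openin_mtopology_subset by blast
    show "h \<in> space (borel_on S d) \<rightarrow> T" using continuous_map_image_subset_topspace[OF h] by auto
    fix U assume "U \<in> {U. openin T.mtopology U}"
    then have "openin S.mtopology {x \<in> topspace S.mtopology. h x \<in> U}"
      using h by (intro openin_continuous_map_preimage) auto
    moreover have "h -` U \<inter> S = {x \<in> topspace S.mtopology. h x \<in> U}" by auto
    ultimately show "h -` U \<inter> space (borel_on S d) \<in> sets (borel_on S d)"
      by (simp add: S.sets_borel_on)
  qed
  with \<mu> show ?thesis by (simp cong: measurable_cong_sets)
qed

section \<open>Invariant probability measures of contractions\<close>

definition invariant_prob ::
  "'a set \<Rightarrow> ('a \<Rightarrow> 'a \<Rightarrow> real) \<Rightarrow> ('i::finite \<Rightarrow> 'a \<Rightarrow> 'a) \<Rightarrow> ('i \<Rightarrow> real) \<Rightarrow> 'a measure \<Rightarrow> bool" where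
  "invariant_prob S d g p \<mu> \<longleftrightarrow> sets \<mu> = sets (borel_on S d) \<and> prob_space \<mu> \<and>
     (\<forall>B\<in>sets (borel_on S d).
        measure \<mu> B = (\<Sum>i\<in>UNIV. p i * measure (distr \<mu> (borel_on S d) (g i)) B))"

text \<open>Iterating the invariance equation \<open>k\<close> times: the \<open>k\<close>-fold compositions whose image meets \<open>C\<close>
  have their whole image in the \<open>c ^ k * D\<close>-neighbourhood of \<open>C\<close>.\<close>

lemma (in Metric_space) invariant_prob_neighbourhood_le:
  fixes g :: "'i::finite \<Rightarrow> 'a \<Rightarrow> 'a"
  assumes \<mu>: "invariant_prob M d g p \<mu>" and \<nu>: "invariant_prob M d g p \<nu>"
    and p: "\<And>i. 0 \<le> p i"
    and D: "\<And>x y. x \<in> M \<Longrightarrow> y \<in> M \<Longrightarrow> d x y \<le> D"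
    and c: "0 \<le> c" and gM: "\<And>i. g i \<in> M \<rightarrow> M"
    and g: "\<And>i x y. x \<in> M \<Longrightarrow> y \<in> M \<Longrightarrow> d (g i x) (g i y) \<le> c * d x y"
  shows "C \<in> sets (borel_on M d) \<Longrightarrow> E \<in> sets (borel_on M d) \<Longrightarrow>
    (\<And>x y. x \<in> C \<Longrightarrow> y \<in> M \<Longrightarrow> d x y \<le> c ^ k * D \<Longrightarrow> y \<in> E) \<Longrightarrow> measure \<mu> C \<le> measure \<nu> E"
proof (induction k arbitrary: C E)
  note inv = \<mu>[unfolded invariant_prob_def] \<nu>[unfolded invariant_prob_def]
  interpret \<mu>: prob_space \<mu> using inv by simp
  interpret \<nu>: prob_space \<nu> using inv by simp
  have sp: "space \<mu> = M" "space \<nu> = M"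
    using inv by (metis sets_eq_imp_space_eq space_borel_on)+
  {
    case 0
    show ?case
    proof (cases "C = {}")
      case False
      then obtain x where "x \<in> C" by blast
      moreover have "x \<in> M" using calculation 0(1) sets.sets_into_space by fastforce
      \<comment> \<open>At k = 0 the radius is \<open>D\<close>, which bounds all distances: the
        neighbourhood of a single point is the whole space, so \<open>E\<close> has mass 1.\<close>
      ultimately have "M \<subseteq> E" using 0(3)[of x] D by auto
      moreover have "E \<subseteq> M" using sets.sets_into_space[OF 0(2)] by simp
      ultimately have "E = space \<nu>" using sp by simp
      then show ?thesis by (simp only: \<nu>.prob_space \<mu>.prob_le_1)
    qed simp
  next
    case (Suc k)
    have meas: "g i \<in> measurable \<kappa> (borel_on M d)" if "sets \<kappa> = sets (borel_on M d)" for i \<kappa>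
      by (rule measurable_borel_on[OF Metric_space_axioms Metric_space_axioms _ that],
          rule Lipschitz_continuous_map_mtopology[OF Metric_space_axioms Metric_space_axioms gM[of i]])
        (rule g[of _ _ i])
    have step: "measure (distr \<mu> (borel_on M d) (g i)) C \<le> measure (distr \<nu> (borel_on M d) (g i)) E" for i
    proof -
      \<comment> \<open>The preimages of \<open>C\<close> and \<open>E\<close> under
        \<open>g i\<close> satisfy the hypothesis for k: points within \<open>c ^ k * D\<close> of
        each other are mapped to points within \<open>c ^ Suc k * D\<close>.\<close>
      have "measure \<mu> (g i -` C \<inter> M) \<le> measure \<nu> (g i -` E \<inter> M)"
      proof (rule Suc.IH)
        fix x y assume x: "x \<in> g i -` C \<inter> M" and y: "y \<in> M" and xy: "d x y \<le> c ^ k * D"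
        have "d (g i x) (g i y) \<le> c * d x y" using x y by (intro g) auto
        also have "\<dots> \<le> c ^ Suc k * D" using mult_left_mono[OF xy c] by (simp add: mult.assoc)
        finally show "y \<in> g i -` E \<inter> M"
          using Suc.prems(3)[of "g i x" "g i y"] x y funcset_mem[OF gM[of i]] by simp
      qed (use measurable_sets[OF meas[OF refl]] Suc.prems in auto)
      then show ?thesis
        using meas[of \<mu> i] meas[of \<nu> i] inv Suc.prems sp by (simp add: measure_distr)
    qed
    have "measure \<mu> C = (\<Sum>i\<in>UNIV. p i * measure (distr \<mu> (borel_on M d) (g i)) C)"
      using inv Suc.prems by blast
    also have "\<dots> \<le> (\<Sum>i\<in>UNIV. p i * measure (distr \<nu> (borel_on M d) (g i)) E)"
      by (intro sum_mono mult_left_mono step p)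
    also have "\<dots> = measure \<nu> E" using inv Suc.prems by metis
    finally show ?case .
  }
qed

text \<open>For each n, some k makes \<open>c ^ k * D\<close> smaller than the radius of the open
  neighbourhood \<open>E n\<close> of \<open>C\<close>, so \<nu> gives \<open>E n\<close> at least
  the mass that \<mu> gives \<open>C\<close>. A closed set is the decreasing intersection of such
  neighbourhoods, and continuity from above finishes.\<close>

lemma (in Metric_space) invariant_prob_closed_le:
  fixes g :: "'i::finite \<Rightarrow> 'a \<Rightarrow> 'a"
  assumes \<mu>: "invariant_prob M d g p \<mu>" and \<nu>: "invariant_prob M d g p \<nu>"
    and p: "\<And>i. 0 \<le> p i"
    and D: "\<And>x y. x \<in> M \<Longrightarrow> y \<in> M \<Longrightarrow> d x y \<le> D"
    and c: "0 \<le> c" "c < 1" and gM: "\<And>i. g i \<in> M \<rightarrow> M"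
    and g: "\<And>i x y. x \<in> M \<Longrightarrow> y \<in> M \<Longrightarrow> d (g i x) (g i y) \<le> c * d x y"
    and C: "closedin mtopology C"
  shows "measure \<mu> C \<le> measure \<nu> C"
proof -
  interpret \<nu>: prob_space \<nu> using \<nu> by (simp add: invariant_prob_def)
  have CM: "C \<subseteq> M" using C closedin_subset by fastforce
  define E where "E n = (\<Union>x\<in>C. mball x (inverse (real (Suc n))))" for n
  have "openin mtopology (M - C)" using C by (simp add: closedin_def)
  then have "M - (M - C) \<in> sets (borel_on M d)"
    unfolding sets_borel_on by (intro sigma_sets.Compl sigma_sets.Basic) simp
  then have C_sets: "C \<in> sets (borel_on M d)" using CM by (simp add: Diff_Diff_Int Int_absorb1)
  have E_sets: "E n \<in> sets (borel_on M d)" for n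
    unfolding sets_borel_on E_def by (intro sigma_sets.Basic CollectI openin_Union) auto
  have le: "measure \<mu> C \<le> measure \<nu> (E n)" for n
  proof -
    have "(\<lambda>k. c ^ k * D) \<longlonglongrightarrow> 0 * D" using c by (intro tendsto_intros LIMSEQ_power_zero) auto
    then have "\<forall>\<^sub>F k in sequentially. c ^ k * D < inverse (real (Suc n))"
      by (intro order_tendstoD) auto
    then obtain k where "c ^ k * D < inverse (real (Suc n))" by (auto simp: eventually_sequentially)
    then show ?thesis
      using CM by (intro invariant_prob_neighbourhood_le[OF \<mu> \<nu> p D c(1) gM g C_sets E_sets, of k])
        (force simp: E_def)+
  qed
  have "C = (\<Inter>n. E n)"
  proof
    show "C \<subseteq> (\<Inter>n. E n)" using CM by (auto simp: E_def)
    have "(\<Inter>n. E n) \<subseteq> mtopology closure_of C"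
      unfolding metric_closure_of
    proof (clarify, intro conjI allI impI)
      fix y and r :: real assume y: "y \<in> (\<Inter>n. E n)"
      from y show "y \<in> M" by (auto simp: E_def)
      assume "0 < r"
      then obtain n where n: "inverse (real (Suc n)) < r" using reals_Archimedean by blast
      from y obtain x where "x \<in> C" "y \<in> mball x (inverse (real (Suc n)))" by (auto simp: E_def)
      with n show "\<exists>x\<in>C. x \<in> mball y r" by (intro bexI[of _ x]) (auto simp: commute)
    qed
    then show "(\<Inter>n. E n) \<subseteq> C" using C by (simp add: closure_of_closedin)
  qed
  moreover have "decseq E"
  proof (intro decseq_SucI)
    show "E (Suc n) \<subseteq> E n" for n
      unfolding E_def by (intro UN_mono mball_subset_concentric) (auto simp: field_simps)
  qed
  moreover have "range E \<subseteq> sets \<nu>" using E_sets \<nu> by (auto simp: invariant_prob_def)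
  ultimately have "(\<lambda>n. measure \<nu> (E n)) \<longlonglongrightarrow> measure \<nu> C"
    using \<nu>.finite_Lim_measure_decseq[of E] by simp
  then show ?thesis using le by (intro LIMSEQ_le_const) auto
qed

text \<open>By symmetry the inequality on closed sets is an equality. Complements carry it to the
  open sets, an intersection-stable generator of the Borel sets that contains the whole
  space.\<close>

lemma (in Metric_space) invariant_prob_unique:
  fixes g :: "'i::finite \<Rightarrow> 'a \<Rightarrow> 'a"
  assumes \<mu>: "invariant_prob M d g p \<mu>" and \<nu>: "invariant_prob M d g p \<nu>"
    and p: "\<And>i. 0 \<le> p i"
    and D: "\<And>x y. x \<in> M \<Longrightarrow> y \<in> M \<Longrightarrow> d x y \<le> D"
    and c: "0 \<le> c" "c < 1" and gM: "\<And>i. g i \<in> M \<rightarrow> M"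
    and g: "\<And>i x y. x \<in> M \<Longrightarrow> y \<in> M \<Longrightarrow> d (g i x) (g i y) \<le> c * d x y"
  shows "\<mu> = \<nu>"
proof -
  note inv = \<mu>[unfolded invariant_prob_def] \<nu>[unfolded invariant_prob_def]
  interpret \<mu>: prob_space \<mu> using inv by simp
  interpret \<nu>: prob_space \<nu> using inv by simp
  have sp: "space \<mu> = M" "space \<nu> = M"
    using inv by (metis sets_eq_imp_space_eq space_borel_on)+
  show ?thesis
  proof (rule measure_eqI_generator_eq[where E = "{U. openin mtopology U}" and \<Omega> = M and A = "\<lambda>_. M"])
    fix U assume "U \<in> {U. openin mtopology U}"
    then have U: "openin mtopology U" "U \<subseteq> M" using openin_mtopology_subset by auto
    then have "U \<in> sets (borel_on M d)" by (simp add: sets_borel_on)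
    then have "U \<in> sets \<mu>" "U \<in> sets \<nu>" using inv by auto
    moreover have "closedin mtopology (M - U)"
      using U by (auto simp: closedin_def Diff_Diff_Int Int_absorb1)
    then have "measure \<mu> (M - U) = measure \<nu> (M - U)"
      using invariant_prob_closed_le[OF \<mu> \<nu> p D c gM g] invariant_prob_closed_le[OF \<nu> \<mu> p D c gM g]
      by (meson order_antisym)
    ultimately have "measure \<mu> U = measure \<nu> U"
      using \<mu>.prob_compl[of U] \<nu>.prob_compl[of U] sp by simp
    then show "emeasure \<mu> U = emeasure \<nu> U"
      by (simp add: \<mu>.emeasure_eq_measure \<nu>.emeasure_eq_measure)
  next
    show "Int_stable {U. openin mtopology U}" by (auto simp: Int_stable_def)
    show "sets \<mu> = sigma_sets M {U. openin mtopology U}" "sets \<nu> = sigma_sets M {U. openin mtopology U}"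
      using inv sets_borel_on by auto
  qed (use openin_mtopology_subset in auto)
qed

lemma measure_attractor_eq: "measure_attractor S d g p = (THE \<mu>. invariant_prob S d g p \<mu>)"
  by (simp only: measure_attractor_def invariant_prob_def)

lemma measure_attractor_eqI:
  fixes g :: "'i::finite \<Rightarrow> 'a \<Rightarrow> 'a"
  assumes S: "Metric_space S d" and \<mu>: "invariant_prob S d g p \<mu>"
    and p: "\<And>i. 0 \<le> p i"
    and D: "\<And>x y. x \<in> S \<Longrightarrow> y \<in> S \<Longrightarrow> d x y \<le> D"
    and c: "0 \<le> c" "c < 1" and gS: "\<And>i. g i \<in> S \<rightarrow> S"
    and g: "\<And>i x y. x \<in> S \<Longrightarrow> y \<in> S \<Longrightarrow> d (g i x) (g i y) \<le> c * d x y"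
  shows "measure_attractor S d g p = \<mu>"
  unfolding measure_attractor_eq
proof (rule the_equality)
  fix \<nu> assume "invariant_prob S d g p \<nu>"
  then show "\<nu> = \<mu>"
    using \<mu> p D c gS g by (rule Metric_space.invariant_prob_unique[OF S])
qed (rule \<mu>)

text \<open>Given the semiconjugacy \<open>h (g i x) = k i (h x)\<close>, invariance of \<mu>
  evaluated at the preimage of \<open>B\<close> under \<open>h\<close> is the invariance equation of
  the push-forward at \<open>B\<close>.\<close>

lemma invariant_prob_distr:
  fixes g :: "'i::finite \<Rightarrow> 'a \<Rightarrow> 'a"
  assumes S: "Metric_space S d" and T: "Metric_space T e"
    and \<mu>: "invariant_prob S d g p \<mu>"
    and h: "continuous_map (Metric_space.mtopology S d) (Metric_space.mtopology T e) h"
    and g: "\<And>i. continuous_map (Metric_space.mtopology S d) (Metric_space.mtopology S d) (g i)"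
    and k: "\<And>i. continuous_map (Metric_space.mtopology T e) (Metric_space.mtopology T e) (k i)"
    and eq: "\<And>i x. x \<in> S \<Longrightarrow> h (g i x) = k i (h x)"
  shows "invariant_prob T e k p (distr \<mu> (borel_on T e) h)"
proof -
  note inv = \<mu>[unfolded invariant_prob_def]
  interpret prob_space \<mu> using inv by simp
  interpret S: Metric_space S d by fact
  have sp: "space \<mu> = S" using inv by (metis sets_eq_imp_space_eq S.space_borel_on)
  have [measurable]: "h \<in> measurable \<mu> (borel_on T e)" "h \<in> measurable (borel_on S d) (borel_on T e)"
    using inv measurable_borel_on[OF S T h] by auto
  have [measurable]: "g i \<in> measurable \<mu> (borel_on S d)" for i
    using inv measurable_borel_on[OF S S g] by auto
  have [measurable]: "k i \<in> measurable (borel_on T e) (borel_on T e)" for i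
    using measurable_borel_on[OF T T k] by auto
  have comm: "distr (distr \<mu> (borel_on S d) (g i)) (borel_on T e) h =
      distr (distr \<mu> (borel_on T e) h) (borel_on T e) (k i)" for i
    by (simp add: distr_distr, rule distr_cong) (auto simp: sp eq)
  show ?thesis
    unfolding invariant_prob_def
  proof (intro conjI ballI)
    show "prob_space (distr \<mu> (borel_on T e) h)" by (rule prob_space_distr) measurable
    fix B assume B [measurable]: "B \<in> sets (borel_on T e)"
    have hB: "h -` B \<inter> S \<in> sets (borel_on S d)"
      using measurable_sets[of h "borel_on S d" "borel_on T e" B] by simp
    have "measure (distr \<mu> (borel_on T e) h) B = measure \<mu> (h -` B \<inter> S)"
      by (simp add: measure_distr sp)
    also have "\<dots> = (\<Sum>i\<in>UNIV. p i * measure (distr \<mu> (borel_on S d) (g i)) (h -` B \<inter> S))"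
      using inv hB by blast
    also have "\<dots> = (\<Sum>i\<in>UNIV. p i * measure (distr (distr \<mu> (borel_on S d) (g i)) (borel_on T e) h) B)"
      by (simp add: measure_distr[of h])
    finally show "measure (distr \<mu> (borel_on T e) h) B =
      (\<Sum>i\<in>UNIV. p i * measure (distr (distr \<mu> (borel_on T e) h) (borel_on T e) (k i)) B)"
      by (simp only: comm)
  qed simp
qed

section \<open>The attractors of the superIFS on code trees\<close>

lemma power_carrier_UNIV [simp]: "power_carrier UNIV = UNIV"
  by (simp add: power_carrier_def)

lemma Metric_space_tree_tuples:
  "Metric_space UNIV (max_dist code_tree_dist :: ('v::finite \<Rightarrow> ('m::finite, 'n) code_tree) \<Rightarrow> _)"
  using Metric_space_power[OF Metric_space_code_tree] by simp

section \<open>Distances between code trees\<close>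

text \<open>Trades the \<open>LEAST\<close> in the metric for a condition on single positions, so
  that later estimates only follow a position where two trees differ. For equal trees just the
  conjunct \<open>0 \<le> c\<close> remains.\<close>

lemma code_tree_dist_le_iff:
  fixes \<omega> \<kappa> :: "('m::finite, 'n) code_tree"
  shows "code_tree_dist \<omega> \<kappa> \<le> c \<longleftrightarrow>
    0 \<le> c \<and> (\<forall>i. \<omega> i \<noteq> \<kappa> i \<longrightarrow> 1 / real CARD('m) ^ length i \<le> c)"
proof (cases "\<omega> = \<kappa>")
  case False
  let ?k = "LEAST k. \<exists>i. length i = k \<and> \<omega> i \<noteq> \<kappa> i"
  have d: "code_tree_dist \<omega> \<kappa> = 1 / real CARD('m) ^ ?k"
    using False by (simp add: code_tree_dist_def)
  from False have "\<exists>k i. length i = k \<and> \<omega> i \<noteq> \<kappa> i" by auto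
  from LeastI_ex[OF this] obtain i where i: "length i = ?k" "\<omega> i \<noteq> \<kappa> i" by blast
  have ge: "1 / real CARD('m) ^ length j \<le> 1 / real CARD('m) ^ ?k" if "\<omega> j \<noteq> \<kappa> j" for j
  proof -
    have "?k \<le> length j" using that by (auto intro: Least_le)
    then show ?thesis by (intro divide_left_mono power_increasing) (auto simp: Suc_leI)
  qed
  show ?thesis
  proof
    assume c: "code_tree_dist \<omega> \<kappa> \<le> c"
    have "0 \<le> 1 / real CARD('m) ^ ?k" by simp
    then show "0 \<le> c \<and> (\<forall>i. \<omega> i \<noteq> \<kappa> i \<longrightarrow> 1 / real CARD('m) ^ length i \<le> c)"
      using c ge unfolding d by (meson order_trans)
  next
    assume "0 \<le> c \<and> (\<forall>i. \<omega> i \<noteq> \<kappa> i \<longrightarrow> 1 / real CARD('m) ^ length i \<le> c)"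
    then have "1 / real CARD('m) ^ length i \<le> c" using i(2) by blast
    then show "code_tree_dist \<omega> \<kappa> \<le> c" unfolding d i(1) .
  qed
qed (simp add: code_tree_dist_def)

lemma code_tree_dist_less_imp_eq:
  fixes \<omega> \<kappa> :: "('m::finite, 'n) code_tree"
  assumes "code_tree_dist \<omega> \<kappa> < 1 / real CARD('m) ^ k" "length i < k"
  shows "\<omega> i = \<kappa> i"
proof (rule ccontr)
  assume "\<omega> i \<noteq> \<kappa> i"
  then have "1 / real CARD('m) ^ length i \<le> code_tree_dist \<omega> \<kappa>"
    using code_tree_dist_le_iff[of \<omega> \<kappa> "code_tree_dist \<omega> \<kappa>"] by simp
  moreover have "1 / real CARD('m) ^ k \<le> 1 / real CARD('m) ^ length i"
    using assms(2) by (intro divide_left_mono power_increasing) (auto simp: Suc_leI)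
  ultimately show False using assms(1) by linarith
qed

text \<open>The results have the same roots, and a difference at \<open>m # j\<close> comes from a
  difference of two input trees at \<open>j\<close>. Every difference thus sinks by one level, which
  costs one factor 1/M.\<close>

lemma tree_step_contraction:
  fixes \<omega> \<kappa> :: "'v::finite \<Rightarrow> ('m::finite, 'n) code_tree"
  shows "max_dist code_tree_dist (tree_step a \<omega>) (tree_step a \<kappa>)
    \<le> 1 / real CARD('m) * max_dist code_tree_dist \<omega> \<kappa>"
  unfolding max_dist_le_iff code_tree_dist_le_iff
proof (intro allI conjI impI)
  interpret Metric_space UNIV "max_dist code_tree_dist :: ('v \<Rightarrow> ('m, 'n) code_tree) \<Rightarrow> _"
    by (rule Metric_space_tree_tuples)
  show "0 \<le> 1 / real CARD('m) * max_dist code_tree_dist \<omega> \<kappa>" by simp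
  fix v i assume neq: "tree_step a \<omega> v i \<noteq> tree_step a \<kappa> v i"
  then obtain m j where i: "i = m # j" by (cases i) (auto simp: tree_step_def)
  let ?w = "snd (a v) m"
  from neq have "\<omega> ?w j \<noteq> \<kappa> ?w j" by (simp add: i tree_step_def)
  then have "1 / real CARD('m) ^ length j \<le> code_tree_dist (\<omega> ?w) (\<kappa> ?w)"
    using code_tree_dist_le_iff[of "\<omega> ?w" "\<kappa> ?w" "code_tree_dist (\<omega> ?w) (\<kappa> ?w)"] by simp
  also have "\<dots> \<le> max_dist code_tree_dist \<omega> \<kappa>" by (rule max_dist_ge)
  finally have "1 / real CARD('m) * (1 / real CARD('m) ^ length j)
      \<le> 1 / real CARD('m) * max_dist code_tree_dist \<omega> \<kappa>"
    by (rule mult_left_mono) simp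
  then show "1 / real CARD('m) ^ length i \<le> 1 / real CARD('m) * max_dist code_tree_dist \<omega> \<kappa>"
    by (simp add: i)
qed

lemma tree_dist_le_1:
  fixes \<omega> \<kappa> :: "'v::finite \<Rightarrow> ('m::finite, 'n) code_tree"
  shows "max_dist code_tree_dist \<omega> \<kappa> \<le> 1"
  unfolding max_dist_le_iff code_tree_dist_le_iff by (simp add: Suc_leI)

section \<open>The coding map and its image\<close>

text \<open>\<open>code s\<close> is the point \<open>lim\<^sub>k \<eta> (s 0) (\<dots> (\<eta> (s k) \<omega>))\<close>: the entries at depth \<open>k\<close> depend
  only on the first \<open>k + 1\<close> letters of \<open>s\<close>.\<close>

fun code :: "('v, 'n, 'm) super_index stream \<Rightarrow> 'v \<Rightarrow> ('m, 'n) code_tree" where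
  "code s v [] = fst (shd s v)"
| "code s v (m # i) = code (stl s) (snd (shd s v) m) i"

text \<open>Prepending a letter to a stream is applying the corresponding map of the IFS. Splitting
  streams into head and tail then gives invariance both of the range of \<open>code\<close> and of
  the Bernoulli push-forward.\<close>

lemma code_Stream: "code (a ## s) = tree_step a (code s)"
proof (intro ext)
  fix v i show "code (a ## s) v i = tree_step a (code s) v i"
    by (cases i) (simp_all add: tree_step_def)
qed

lemma code_cong: "(\<And>j. j \<le> length i \<Longrightarrow> s !! j = t !! j) \<Longrightarrow> code s v i = code t v i"
proof (induction i arbitrary: s t v)
  case Nil
  then show ?case using Nil.prems[of 0] by simp
next
  case (Cons m i)
  have "shd s = shd t" using Cons.prems[of 0] by simp
  moreover have "stl s !! j = stl t !! j" if "j \<le> length i" for j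
    using Cons.prems[of "Suc j"] that by simp
  ultimately show ?case using Cons.IH[of "stl s" "stl t"] by simp
qed

lemma max_dist_code_le:
  fixes s t :: "('v::finite, 'n, 'm::finite) super_index stream"
  assumes "\<And>j. j < k \<Longrightarrow> s !! j = t !! j"
  shows "max_dist code_tree_dist (code s) (code t) \<le> 1 / real CARD('m) ^ k"
  unfolding max_dist_le_iff code_tree_dist_le_iff
proof (intro allI conjI impI)
  fix v i assume "code s v i \<noteq> code t v i"
  then obtain j where "j \<le> length i" "s !! j \<noteq> t !! j" using code_cong[of i s t v] by auto
  then have "k \<le> length i" using assms[of j] by (meson le_trans not_le)
  then show "1 / real CARD('m) ^ length i \<le> 1 / real CARD('m) ^ k"
    by (intro divide_left_mono power_increasing) (auto simp: Suc_leI)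
qed simp

text \<open>Continuity is stated through common prefixes because these describe at once the basic
  open sets of the product topology and the cylinders \<open>sstart\<close> of the stream
  sigma-algebra.\<close>

lemma code_uniformly_continuous:
  assumes "2 \<le> CARD('m)" "0 < \<epsilon>"
  obtains k where "\<And>s t :: ('v::finite, 'n, 'm::finite) super_index stream.
    (\<And>j. j < k \<Longrightarrow> s !! j = t !! j) \<Longrightarrow> max_dist code_tree_dist (code s) (code t) < \<epsilon>"
proof -
  have "1 / real CARD('m) < 1" using assms(1) by simp
  then obtain k where "(1 / real CARD('m)) ^ k < \<epsilon>" using real_arch_pow_inv assms(2) by blast
  then have k: "1 / real CARD('m) ^ k < \<epsilon>" by (simp add: power_one_over)
  show thesis
    by (rule that) (rule le_less_trans[OF max_dist_code_le k])
qed

text \<open>A power of a finite discrete space is compact by Tychonoff, and \<open>code\<close> is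
  continuous on it. Sequences as functions on \<open>nat\<close> stand in for streams, with
  \<open>to_stream\<close> as the translation.\<close>

lemma compactin_range_code:
  assumes "2 \<le> CARD('m)"
  shows "compactin (Metric_space.mtopology UNIV (max_dist code_tree_dist))
    (range (code :: ('v::finite, 'n::finite, 'm::finite) super_index stream \<Rightarrow> _))"
proof -
  interpret Metric_space UNIV "max_dist code_tree_dist :: ('v \<Rightarrow> ('m, 'n) code_tree) \<Rightarrow> _"
    by (rule Metric_space_tree_tuples)
  let ?X = "product_topology (\<lambda>_::nat. discrete_topology (UNIV :: ('v, 'n, 'm) super_index set)) UNIV"
  have "continuous_map ?X mtopology (\<lambda>x. code (to_stream x))"
    unfolding continuous_map_to_metric
  proof (intro ballI allI impI)
    fix x :: "nat \<Rightarrow> ('v, 'n, 'm) super_index" and \<epsilon> :: real assume "0 < \<epsilon>"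
    then obtain k where k: "\<And>s t :: ('v, 'n, 'm) super_index stream.
        (\<And>j. j < k \<Longrightarrow> s !! j = t !! j) \<Longrightarrow> max_dist code_tree_dist (code s) (code t) < \<epsilon>"
      using code_uniformly_continuous[OF assms] by metis
    \<comment> \<open>The cylinder of all sequences that agree with \<open>x\<close> below k; it is
      open because only finitely many coordinates are restricted.\<close>
    let ?U = "PiE UNIV (\<lambda>j. if j < k then {x j} else UNIV)"
    have "finite {j. (if j < k then {x j} else UNIV) \<noteq> UNIV}"
      by (rule finite_subset[of _ "{..<k}"]) auto
    then have "openin ?X ?U" by (subst openin_PiE_gen) auto
    moreover have "x \<in> ?U" by auto
    moreover have "code (to_stream y) \<in> mball (code (to_stream x)) \<epsilon>" if "y \<in> ?U" for y
    proof -
      have "x j = y j" if "j < k" for j using PiE_mem[OF \<open>y \<in> ?U\<close>, of j] that by simp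
      then show ?thesis using k[of "to_stream x" "to_stream y"] by (simp add: to_stream_def)
    qed
    ultimately show "\<exists>U. openin ?X U \<and> x \<in> U \<and>
        (\<forall>y\<in>U. code (to_stream y) \<in> mball (code (to_stream x)) \<epsilon>)"
      by blast
  qed
  moreover have "compact_space ?X"
    by (auto simp: compact_space_product_topology compact_space_discrete_topology)
  ultimately have "compactin mtopology ((\<lambda>x. code (to_stream x)) ` topspace ?X)"
    by (intro image_compactin) (auto simp: compact_space_def)
  also have "(\<lambda>x. code (to_stream x)) ` topspace ?X = range (code :: ('v, 'n, 'm) super_index stream \<Rightarrow> _)"
  proof -
    have "to_stream (snth s) = s" for s :: "('v, 'n, 'm) super_index stream"
      using stream_smap_nats[of s] by (simp add: to_stream_def)
    then show ?thesis by (auto simp: image_iff) metis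
  qed
  finally show ?thesis .
qed

lemma range_code_invariant: "range code = (\<Union>a. tree_step a ` range code)"
proof
  show "range code \<subseteq> (\<Union>a. tree_step a ` range code)"
  proof (rule image_subsetI)
    fix s show "code s \<in> (\<Union>a. tree_step a ` range code)"
      using code_Stream[of "shd s" "stl s"] by auto
  qed
  show "(\<Union>a. tree_step a ` range code) \<subseteq> range code"
    by (auto simp: code_Stream[symmetric])
qed

lemma tree_attractor_eq:
  assumes "2 \<le> CARD('m::finite)"
  shows "tree_attractor = range (code :: ('v::finite, 'n::finite, 'm) super_index stream \<Rightarrow> _)"
  unfolding tree_attractor_def power_carrier_UNIV
proof (rule set_attractor_eqI[OF Metric_space_tree_tuples])
  show "compactin (Metric_space.mtopology UNIV (max_dist code_tree_dist))
      (range (code :: ('v, 'n, 'm) super_index stream \<Rightarrow> _))"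
    by (rule compactin_range_code[OF assms])
  show "range code = (\<Union>a :: ('v, 'n, 'm) super_index. tree_step a ` range code)"
    by (rule range_code_invariant)
  show "max_dist code_tree_dist (tree_step a \<omega>) (tree_step a \<kappa>)
      \<le> 1 / real CARD('m) * max_dist code_tree_dist \<omega> \<kappa>"
    for a :: "('v, 'n, 'm) super_index" and \<omega> \<kappa>
    by (rule tree_step_contraction)
qed (use assms in auto)

lemma continuous_tree_step:
  fixes a :: "('v::finite, 'n, 'm::finite) super_index"
  shows "continuous_map (Metric_space.mtopology UNIV (max_dist code_tree_dist))
    (Metric_space.mtopology UNIV (max_dist code_tree_dist)) (tree_step a)"
  by (rule Lipschitz_continuous_map_mtopology[OF Metric_space_tree_tuples Metric_space_tree_tuples])
    (simp, rule tree_step_contraction)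

text \<open>The preimage of an open set contains, with each stream, a whole cylinder around it.
  Cylinders are indexed by finite words over a finite alphabet, so the union is countable and hence
  measurable.\<close>

lemma measurable_code:
  fixes q :: "('v::finite, 'n::finite, 'm::finite) super_index pmf"
  assumes "2 \<le> CARD('m)"
  shows "code \<in> measurable (stream_space (measure_pmf q)) (borel_on UNIV (max_dist code_tree_dist))"
  unfolding borel_on_def
proof (rule measurable_measure_of)
  interpret Metric_space UNIV "max_dist code_tree_dist :: ('v \<Rightarrow> ('m, 'n) code_tree) \<Rightarrow> _"
    by (rule Metric_space_tree_tuples)
  fix U assume "U \<in> {U. openin mtopology U}"
  then have U: "openin mtopology U" by simp
  let ?W = "{w. sstart UNIV w \<subseteq> code -` U}"
  have "code -` U = (\<Union>w\<in>?W. sstart UNIV w)"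
  proof
    show "code -` U \<subseteq> (\<Union>w\<in>?W. sstart UNIV w)"
    proof
      fix s assume "s \<in> code -` U"
      then obtain \<epsilon> where \<epsilon>: "0 < \<epsilon>" "mball (code s) \<epsilon> \<subseteq> U" using U by (auto simp: openin_mtopology)
      obtain k where k: "\<And>s t :: ('v, 'n, 'm) super_index stream.
          (\<And>j. j < k \<Longrightarrow> s !! j = t !! j) \<Longrightarrow> max_dist code_tree_dist (code s) (code t) < \<epsilon>"
        using code_uniformly_continuous[OF assms \<epsilon>(1)] by metis
      have "t \<in> code -` U" if "t \<in> sstart UNIV (stake k s)" for t
        using k[of s t] \<epsilon>(2) that by (force simp: sstart_eq)
      moreover have "s \<in> sstart UNIV (stake k s)" by (simp add: sstart_eq)
      ultimately show "s \<in> (\<Union>w\<in>?W. sstart UNIV w)" by blast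
    qed
  qed auto
  moreover have "(\<Union>w\<in>?W. sstart UNIV w) \<in> sets (stream_space (count_space UNIV))"
    by (intro sets.countable_UN'' countableI_type sets_sstart)
  moreover have "sets (stream_space (measure_pmf q)) = sets (stream_space (count_space UNIV))"
    by (intro sets_stream_space_cong) simp
  ultimately show "code -` U \<inter> space (stream_space (measure_pmf q)) \<in> sets (stream_space (measure_pmf q))"
    by (simp add: space_stream_space)
qed auto

section \<open>The Bernoulli measure as measure attractor\<close>

text \<open>An independent stream is a first letter with law \<open>p\<close> followed by an
  independent copy of the stream. Under \<open>code\<close> this self-similarity becomes the
  invariance equation, since \<open>code (a ## s)\<close> is
  \<open>tree_step a (code s)\<close>.\<close>

lemma invariant_prob_code:
  fixes p :: "('v::finite, 'n::finite, 'm::finite) super_index \<Rightarrow> real"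
  assumes M: "2 \<le> CARD('m)" and p: "\<And>a. 0 \<le> p a" "(\<Sum>a\<in>UNIV. p a) = 1"
  shows "invariant_prob UNIV (max_dist code_tree_dist) tree_step p
    (distr (stream_space (measure_pmf (embed_pmf p))) (borel_on UNIV (max_dist code_tree_dist)) code)"
proof -
  let ?q = "measure_pmf (embed_pmf p)"
  let ?P = "stream_space ?q"
  let ?B = "borel_on UNIV (max_dist code_tree_dist) :: ('v \<Rightarrow> ('m, 'n) code_tree) measure"
  have "(\<integral>\<^sup>+a. ennreal (p a) \<partial>count_space UNIV) = 1"
    using p by (simp add: nn_integral_count_space_finite sum_ennreal)
  then have pmf: "pmf (embed_pmf p) a = p a" for a using p by (intro pmf_embed_pmf) auto
  interpret P: prob_space ?P
    by (rule prob_space.prob_space_stream_space[OF prob_space_measure_pmf])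
  have [measurable]: "code \<in> measurable ?P ?B" by (rule measurable_code[OF M])
  have [measurable]: "tree_step a \<in> measurable ?B ?B" for a :: "('v, 'n, 'm) super_index"
    by (rule measurable_borel_on[OF Metric_space_tree_tuples Metric_space_tree_tuples continuous_tree_step refl])
  show ?thesis
    unfolding invariant_prob_def
  proof (intro conjI ballI)
    show "prob_space (distr ?P ?B code)" by (rule P.prob_space_distr) measurable
    fix B assume [measurable]: "B \<in> sets ?B"
    have m: "code -` B \<in> sets ?P"
      using measurable_sets[of code ?P ?B B] by (simp add: space_stream_space)
    have st: "measure (distr (distr ?P ?B code) ?B (tree_step a)) B = measure ?P {s. a ## s \<in> code -` B}" for a
      by (simp add: distr_distr measure_distr space_stream_space vimage_def code_Stream)
    \<comment> \<open>Conditioning on the first letter; the integral is then a finite sum over the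
      alphabet.\<close>
    have "ennreal (measure ?P (code -` B)) = (\<integral>\<^sup>+a. emeasure ?P {s. a ## s \<in> code -` B} \<partial>?q)"
      using prob_space.emeasure_stream_space[OF prob_space_measure_pmf m]
      by (simp add: P.emeasure_eq_measure space_stream_space)
    also have "\<dots> = (\<Sum>a\<in>UNIV. emeasure ?P {s. a ## s \<in> code -` B} * p a)"
      by (subst nn_integral_measure_pmf_support[of UNIV]) (auto simp: pmf)
    also have "\<dots> = ennreal (\<Sum>a\<in>UNIV. p a * measure ?P {s. a ## s \<in> code -` B})"
      using p by (subst sum_ennreal[symmetric])
        (auto simp: P.emeasure_eq_measure ennreal_mult mult.commute)
    finally have "measure ?P (code -` B) = (\<Sum>a\<in>UNIV. p a * measure ?P {s. a ## s \<in> code -` B})"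
      using p by (subst (asm) ennreal_inj) (auto intro!: sum_nonneg)
    then show "measure (distr ?P ?B code) B =
        (\<Sum>a\<in>UNIV. p a * measure (distr (distr ?P ?B code) ?B (tree_step a)) B)"
      unfolding st by (simp add: measure_distr space_stream_space)
  qed simp
qed

text \<open>Resolves the description behind \<open>tree_measure\<close>: the Bernoulli push-forward
  is a solution, and the contraction ratio 1/M on a space of diameter at most 1 makes it the only
  one.\<close>

lemma invariant_prob_tree_measure:
  fixes p :: "('v::finite, 'n::finite, 'm::finite) super_index \<Rightarrow> real"
  assumes M: "2 \<le> CARD('m)" and p: "\<And>a. 0 \<le> p a" "(\<Sum>a\<in>UNIV. p a) = 1"
  shows "invariant_prob UNIV (max_dist code_tree_dist) tree_step p (tree_measure p)"
proof -
  have "tree_measure p =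
      distr (stream_space (measure_pmf (embed_pmf p))) (borel_on UNIV (max_dist code_tree_dist)) code"
    unfolding tree_measure_def power_carrier_UNIV
  proof (rule measure_attractor_eqI[OF Metric_space_tree_tuples invariant_prob_code[OF M p] p(1)])
    show "max_dist code_tree_dist \<omega> \<kappa> \<le> 1" for \<omega> \<kappa> :: "'v \<Rightarrow> ('m, 'n) code_tree"
      by (rule tree_dist_le_1)
    show "max_dist code_tree_dist (tree_step a \<omega>) (tree_step a \<kappa>)
        \<le> 1 / real CARD('m) * max_dist code_tree_dist \<omega> \<kappa>"
      for a :: "('v, 'n, 'm) super_index" and \<omega> \<kappa>
      by (rule tree_step_contraction)
  qed (use M in auto)
  then show ?thesis using invariant_prob_code[OF M p] by simp
qed

section \<open>The compact set of a code tree\<close>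

lemma UN_image_nonempty_compacts:
  fixes g :: "'m::finite \<Rightarrow> 'x::metric_space \<Rightarrow> 'y::metric_space"
  assumes "\<And>m. continuous_on UNIV (g m)" "\<And>m. A m \<in> nonempty_compacts"
  shows "(\<Union>m. g m ` A m) \<in> nonempty_compacts"
proof -
  have "compact (g m ` A m)" "A m \<noteq> {}" for m
    using assms continuous_on_subset[OF assms(1) subset_UNIV]
    by (auto simp: nonempty_compacts_def intro: compact_continuous_image)
  then show ?thesis by (simp add: nonempty_compacts_def compact_UN)
qed

lemma hausdorff_dist_UN_image_le:
  fixes g :: "'m::finite \<Rightarrow> 'x::metric_space \<Rightarrow> 'y::metric_space"
  assumes g: "\<And>m. l-lipschitz_on UNIV (g m)"
    and A: "\<And>m. A m \<in> nonempty_compacts" and B: "\<And>m. B m \<in> nonempty_compacts"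
    and c: "\<And>m. hausdorff_dist (A m) (B m) \<le> c"
  shows "hausdorff_dist (\<Union>m. g m ` A m) (\<Union>m. g m ` B m) \<le> l * c"
proof -
  have l: "0 \<le> l" using g lipschitz_on_nonneg by blast
  have cont: "continuous_on UNIV (g m)" for m
    using g by (rule lipschitz_on_continuous_on)
  have near: "infdist y (\<Union>m. g m ` D m) \<le> l * c"
    if D: "\<And>m. D m \<in> nonempty_compacts" and y: "y \<in> (\<Union>m. g m ` C m)"
      and le: "\<And>m x. x \<in> C m \<Longrightarrow> infdist x (D m) \<le> c" for C D y
  proof -
    obtain m x where x: "x \<in> C m" "y = g m x" using y by blast
    have "compact (D m)" "D m \<noteq> {}" "continuous_on (D m) (dist x)"
      using D by (auto simp: nonempty_compacts_def intro!: continuous_intros)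
    from continuous_attains_inf[OF this] obtain z
      where z: "z \<in> D m" "\<forall>w\<in>D m. dist x z \<le> dist x w" by blast
    then have "dist x z \<le> infdist x (D m)" by (auto simp: infdist_def intro!: cINF_greatest)
    also have "\<dots> \<le> c" using le x by blast
    finally have "l * dist x z \<le> l * c" using l by (rule mult_left_mono)
    moreover have "dist y (g m z) \<le> l * dist x z"
      unfolding x(2) by (rule lipschitz_onD[OF g]) auto
    moreover have "infdist y (\<Union>m. g m ` D m) \<le> dist y (g m z)" using z by (intro infdist_le) auto
    ultimately show ?thesis by linarith
  qed
  have "infdist x (B m) \<le> c" if "x \<in> A m" for m x
    using hausdorff_dist_le_iff[OF A B] c that by blast
  moreover have "infdist x (A m) \<le> c" if "x \<in> B m" for m x
    using hausdorff_dist_le_iff[OF A B] c that by blast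
  ultimately show ?thesis
    unfolding hausdorff_dist_le_iff[OF UN_image_nonempty_compacts[OF cont A]
        UN_image_nonempty_compacts[OF cont B]]
    by (intro conjI ballI near A B)
qed

section \<open>Level sets of a code tree and their limit\<close>

definition level_set ::
  "('n \<Rightarrow> 'm \<Rightarrow> 'x \<Rightarrow> 'x) \<Rightarrow> ('m, 'n) code_tree \<Rightarrow> nat \<Rightarrow> 'x set \<Rightarrow> 'x set" where
  "level_set f \<sigma> k K = (\<Union>i\<in>{i. length i = k}. branch_map f \<sigma> i ` K)"

text \<open>A nonempty prefix of \<open>m # i\<close> is \<open>m\<close> followed by a prefix of
  \<open>i\<close>, so all maps after the outermost are chosen by the subtree at
  \<open>m\<close>.\<close>

lemma branch_map_Cons:
  "branch_map f \<sigma> (m # i) = f (\<sigma> []) m \<circ> branch_map f (\<lambda>j. \<sigma> (m # j)) i"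
  unfolding branch_map_def length_Cons map_upt_Suc by simp

lemma level_set_0 [simp]: "level_set f \<sigma> 0 K = K"
  by (simp add: level_set_def branch_map_def)

lemma level_set_Suc:
  "level_set f \<sigma> (Suc k) K = (\<Union>m. f (\<sigma> []) m ` level_set f (\<lambda>j. \<sigma> (m # j)) k K)"
proof -
  have eq: "{i. length i = Suc k} = (\<Union>m. (#) m ` {i. length i = k})"
    by (auto simp: length_Suc_conv)
  have "level_set f \<sigma> (Suc k) K =
      (\<Union>m. \<Union>i\<in>{i. length i = k}. branch_map f \<sigma> (m # i) ` K)"
    unfolding level_set_def eq by blast
  then show ?thesis
    unfolding level_set_def branch_map_Cons image_UN image_comp .
qed

text \<open>Starting from the whole space makes the first inclusion trivial, and images and unions
  preserve inclusions. The limit can thus be taken as an intersection.\<close>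

lemma level_set_UNIV_decseq: "decseq (\<lambda>k. level_set f \<sigma> k UNIV)"
proof (rule decseq_SucI)
  fix k show "level_set f \<sigma> (Suc k) UNIV \<subseteq> level_set f \<sigma> k UNIV"
  proof (induction k arbitrary: \<sigma>)
    case (Suc k)
    show ?case
      unfolding level_set_Suc[of f \<sigma> "Suc k"] level_set_Suc[of f \<sigma> k]
      by (intro UN_mono image_mono Suc order_refl)
  qed simp
qed

lemma compact_UNIV_nest:
  fixes C :: "nat \<Rightarrow> 'x::metric_space set"
  assumes "compact (UNIV :: 'x set)" "\<And>k. closed (C k)" "\<And>k. C k \<noteq> {}" "decseq C"
  shows "(\<Inter>k. C k) \<noteq> {}"
  using compact_space_imp_nest[of "euclidean :: 'x topology" C] assms
  by (simp add: compact_space_def)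

locale compact_lipschitz_maps =
  fixes f :: "'n::finite \<Rightarrow> 'm::finite \<Rightarrow> 'x::metric_space \<Rightarrow> 'x" and l :: real
  assumes compact_X: "compact (UNIV :: 'x set)"
    and l_nonneg: "0 \<le> l" and l_less_1: "l < 1"
    and lipschitz: "\<And>n m. l-lipschitz_on UNIV (f n m)"
begin

text \<open>Some upper bound for all distances, not necessarily the least one; it is used only
  through \<open>dist_le_diam\<close>.\<close>

definition diam :: real where
  "diam = (SOME D. \<forall>x y :: 'x. dist x y \<le> D)"

lemma dist_le_diam: "dist x y \<le> diam" for x y :: 'x
proof -
  have "bounded (UNIV :: 'x set)" by (rule compact_imp_bounded[OF compact_X])
  then have "\<exists>D. \<forall>x y :: 'x. dist x y \<le> D" by (auto simp: bounded_two_points)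
  from someI_ex[OF this] show ?thesis by (auto simp: diam_def)
qed

lemma hausdorff_dist_le_diam:
  fixes A B :: "'x set"
  assumes "A \<in> nonempty_compacts" "B \<in> nonempty_compacts"
  shows "hausdorff_dist A B \<le> diam"
proof -
  have "infdist x C \<le> diam" if C: "C \<in> nonempty_compacts" for x and C :: "'x set"
  proof -
    obtain y where "y \<in> C" using C by (auto simp: nonempty_compacts_def)
    then show ?thesis using infdist_le[of y C x] dist_le_diam[of x y] by linarith
  qed
  then show ?thesis using assms by (simp add: hausdorff_dist_le_iff)
qed

lemma continuous: "continuous_on S (f n m)"
  using lipschitz_on_continuous_on[OF lipschitz] continuous_on_subset by blast

lemma UNIV_nonempty_compacts: "(UNIV :: 'x set) \<in> nonempty_compacts"
  using compact_X by (simp add: nonempty_compacts_def)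

lemma level_set_nonempty_compacts:
  "K \<in> nonempty_compacts \<Longrightarrow> level_set f \<sigma> k K \<in> nonempty_compacts"
  by (induction k arbitrary: \<sigma>) (auto simp: level_set_Suc intro!: UN_image_nonempty_compacts continuous)

text \<open>The candidate for the Hausdorff limit, available by compactness before any convergence
  has been shown.\<close>

definition limit_set :: "('m, 'n) code_tree \<Rightarrow> 'x set" where
  "limit_set \<sigma> = (\<Inter>k. level_set f \<sigma> k UNIV)"

lemma closed_level_set: "closed (level_set f \<sigma> k UNIV)"
  using level_set_nonempty_compacts[OF UNIV_nonempty_compacts, of \<sigma> k]
  by (auto simp: nonempty_compacts_def intro: compact_imp_closed)

lemma limit_set_nonempty_compacts: "limit_set \<sigma> \<in> nonempty_compacts"
proof -
  have "limit_set \<sigma> \<noteq> {}"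
    unfolding limit_set_def
    using level_set_nonempty_compacts[OF UNIV_nonempty_compacts]
    by (intro compact_UNIV_nest compact_X closed_level_set level_set_UNIV_decseq)
      (simp add: nonempty_compacts_def)
  moreover have "closed (limit_set \<sigma>)"
    unfolding limit_set_def by (intro closed_INT ballI closed_level_set)
  then have "compact (limit_set \<sigma>)"
    using compact_Int_closed[OF compact_X] by simp
  ultimately show ?thesis by (simp add: nonempty_compacts_def)
qed

text \<open>The delicate point is that an intersection has to pass through a union and through
  images. Finiteness of the set of indices \<open>m\<close> handles the union, compactness of the
  fibres of the maps handles the images.\<close>

lemma limit_set_unfold:
  "limit_set \<sigma> = (\<Union>m. f (\<sigma> []) m ` limit_set (\<lambda>j. \<sigma> (m # j)))"
proof
  show "limit_set \<sigma> \<subseteq> (\<Union>m. f (\<sigma> []) m ` limit_set (\<lambda>j. \<sigma> (m # j)))"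
  proof
    fix x assume x: "x \<in> limit_set \<sigma>"
    \<comment> \<open>The points over \<open>x\<close> in the k-th level set of the subtree at
      \<open>m\<close>; a common point for all k is a preimage of \<open>x\<close> in the limit set
      of that subtree.\<close>
    define C where "C m k = level_set f (\<lambda>j. \<sigma> (m # j)) k UNIV \<inter> f (\<sigma> []) m -` {x}" for m k
    have dec: "decseq (C m)" for m
      using level_set_UNIV_decseq[of f "\<lambda>j. \<sigma> (m # j)"] unfolding C_def decseq_def by blast
    have "\<exists>m. \<forall>k. C m k \<noteq> {}"
    proof (rule ccontr)
      assume "\<nexists>m. \<forall>k. C m k \<noteq> {}"
      then obtain k where k: "\<And>m. C m (k m) = {}" by metis
      \<comment> \<open>A nested fibre that is empty once stays empty, so the largest of the
        finitely many indices empties all fibres together, although \<open>x\<close> lies in the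
        next level set of the full tree.\<close>
      have "k m \<le> Max (range k)" for m by simp
      with k dec have empty: "C m (Max (range k)) = {}" for m unfolding decseq_def by blast
      have "x \<in> level_set f \<sigma> (Suc (Max (range k))) UNIV" using x by (simp add: limit_set_def)
      then show False using empty unfolding level_set_Suc C_def by blast
    qed
    then obtain m where m: "\<And>k. C m k \<noteq> {}" by blast
    have "closed (C m k)" for k
      unfolding C_def
      by (intro closed_Int closed_level_set closed_vimage) (auto intro: continuous)
    then have "(\<Inter>k. C m k) \<noteq> {}" by (intro compact_UNIV_nest compact_X dec m)
    then show "x \<in> (\<Union>m. f (\<sigma> []) m ` limit_set (\<lambda>j. \<sigma> (m # j)))"
      unfolding C_def limit_set_def by blast
  qed
  show "(\<Union>m. f (\<sigma> []) m ` limit_set (\<lambda>j. \<sigma> (m # j))) \<subseteq> limit_set \<sigma>"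
  proof
    fix x assume x: "x \<in> (\<Union>m. f (\<sigma> []) m ` limit_set (\<lambda>j. \<sigma> (m # j)))"
    have "x \<in> level_set f \<sigma> k UNIV" for k
    proof (cases k)
      case (Suc k')
      then show ?thesis using x by (auto simp: limit_set_def level_set_Suc)
    qed simp
    then show "x \<in> limit_set \<sigma>" by (simp add: limit_set_def)
  qed
qed

text \<open>Level set and limit set unfold by the same maps, so each level contributes a factor
  \<open>l\<close>, down to the trivial bound \<open>diam\<close>. The rate does not depend on the
  tree or on \<open>K\<close>.\<close>

lemma hausdorff_dist_level_set:
  assumes K: "K \<in> nonempty_compacts"
  shows "hausdorff_dist (level_set f \<sigma> k K) (limit_set \<sigma>) \<le> l ^ k * diam"
proof (induction k arbitrary: \<sigma>)
  case 0
  then show ?case using hausdorff_dist_le_diam[OF K limit_set_nonempty_compacts] by simp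
next
  case (Suc k)
  show ?case
    unfolding level_set_Suc power_Suc mult.assoc
    by (subst limit_set_unfold, rule hausdorff_dist_UN_image_le[OF lipschitz])
      (intro level_set_nonempty_compacts K limit_set_nonempty_compacts Suc)+
qed

lemma power_diam_eventually_less:
  assumes "0 < \<epsilon>"
  shows "\<forall>\<^sub>F k in sequentially. l ^ k * diam < \<epsilon>"
proof -
  have "(\<lambda>k. l ^ k * diam) \<longlonglongrightarrow> 0 * diam"
    using l_nonneg l_less_1 by (intro tendsto_intros LIMSEQ_power_zero) auto
  then show ?thesis using assms by (intro order_tendstoD) auto
qed

text \<open>The geometric rate gives convergence from every start set; conversely, convergence from
  the single start set \<open>UNIV\<close> already determines the limit.\<close>

lemma tree_set_eq_limit_set: "tree_set f \<sigma> = limit_set \<sigma>"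
proof -
  interpret H: Metric_space nonempty_compacts "hausdorff_dist :: 'x set \<Rightarrow> _"
    by (rule Metric_space_hausdorff)
  have lim: "limitin H.mtopology (\<lambda>k. level_set f \<sigma> k K) (limit_set \<sigma>) sequentially"
    if K: "K \<in> nonempty_compacts" for K
    unfolding H.limitin_metric
  proof (intro conjI allI impI)
    fix \<epsilon> :: real assume "0 < \<epsilon>"
    from power_diam_eventually_less[OF this]
    show "\<forall>\<^sub>F k in sequentially. level_set f \<sigma> k K \<in> nonempty_compacts \<and>
        hausdorff_dist (level_set f \<sigma> k K) (limit_set \<sigma>) < \<epsilon>"
      by (rule eventually_mono)
        (intro conjI level_set_nonempty_compacts[OF K] le_less_trans[OF hausdorff_dist_level_set[OF K]])
  qed (rule limit_set_nonempty_compacts)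
  show ?thesis
    unfolding tree_set_def level_set_def[symmetric]
  proof (rule the_equality)
    fix L assume "\<forall>K\<in>nonempty_compacts. limitin H.mtopology (\<lambda>k. level_set f \<sigma> k K) L sequentially"
    then show "L = limit_set \<sigma>"
      using lim UNIV_nonempty_compacts H.limitin_metric_unique by (metis trivial_limit_sequentially)
  qed (use lim in blast)
qed

lemma tree_set_nonempty_compacts: "tree_set f \<sigma> \<in> nonempty_compacts"
  by (simp add: tree_set_eq_limit_set limit_set_nonempty_compacts)

lemma tree_set_unfold: "tree_set f \<sigma> = (\<Union>m. f (\<sigma> []) m ` tree_set f (\<lambda>j. \<sigma> (m # j)))"
  unfolding tree_set_eq_limit_set by (rule limit_set_unfold)

section \<open>Conjugacy and continuity\<close>

lemma tree_tuple_tree_step: "tree_tuple f (tree_step a \<omega>) = set_step f a (tree_tuple f \<omega>)"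
proof
  fix v
  show "tree_tuple f (tree_step a \<omega>) v = set_step f a (tree_tuple f \<omega>) v"
    unfolding tree_tuple_def set_step_def by (subst tree_set_unfold) (simp add: tree_step_def)
qed

text \<open>While the roots agree, both sets unfold by the same maps and the estimate gains a factor
  \<open>l\<close>; agreement above depth k allows this k times.\<close>

lemma hausdorff_dist_tree_set_le:
  assumes "\<And>i. length i < k \<Longrightarrow> \<sigma> i = \<tau> i"
  shows "hausdorff_dist (tree_set f \<sigma>) (tree_set f \<tau>) \<le> l ^ k * diam"
  using assms
proof (induction k arbitrary: \<sigma> \<tau>)
  case 0
  show ?case using hausdorff_dist_le_diam[OF tree_set_nonempty_compacts tree_set_nonempty_compacts] by simp
next
  case (Suc k)
  have "\<sigma> [] = \<tau> []" using Suc.prems[of "[]"] by simp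
  have "hausdorff_dist (\<Union>m. f (\<tau> []) m ` tree_set f (\<lambda>j. \<sigma> (m # j)))
      (\<Union>m. f (\<tau> []) m ` tree_set f (\<lambda>j. \<tau> (m # j))) \<le> l * (l ^ k * diam)"
    by (rule hausdorff_dist_UN_image_le[OF lipschitz])
      (use Suc.prems in \<open>auto intro!: tree_set_nonempty_compacts Suc.IH\<close>)
  then show ?case
    using \<open>\<sigma> [] = \<tau> []\<close> tree_set_unfold[of \<sigma>] tree_set_unfold[of \<tau>] by (simp add: mult.assoc)
qed

text \<open>The radius is \<open>1 / M ^ k\<close> with k such that
  \<open>l ^ k * diam < \<epsilon>\<close>. It is the same for all trees, so one radius serves all
  components of a tuple.\<close>

lemma tree_set_uniformly_continuous:
  assumes "0 < \<epsilon>"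
  obtains \<delta> where "0 < \<delta>"
    "\<And>\<sigma> \<tau>. code_tree_dist \<sigma> \<tau> < \<delta> \<Longrightarrow> hausdorff_dist (tree_set f \<sigma>) (tree_set f \<tau>) < \<epsilon>"
proof -
  obtain k where k: "l ^ k * diam < \<epsilon>"
    using eventually_happens[OF power_diam_eventually_less[OF assms]] by auto
  show thesis
  proof (rule that)
    show "0 < 1 / real CARD('m) ^ k" by simp
    fix \<sigma> \<tau> :: "('m, 'n) code_tree" assume "code_tree_dist \<sigma> \<tau> < 1 / real CARD('m) ^ k"
    then have "hausdorff_dist (tree_set f \<sigma>) (tree_set f \<tau>) \<le> l ^ k * diam"
      by (intro hausdorff_dist_tree_set_le code_tree_dist_less_imp_eq)
    with k show "hausdorff_dist (tree_set f \<sigma>) (tree_set f \<tau>) < \<epsilon>" by simp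
  qed
qed

lemma continuous_tree_set:
  "continuous_map (Metric_space.mtopology UNIV code_tree_dist)
    (Metric_space.mtopology nonempty_compacts hausdorff_dist) (tree_set f)"
  unfolding Metric_space.metric_continuous_map[OF Metric_space_code_tree Metric_space_hausdorff]
proof (intro conjI ballI allI impI)
  fix \<sigma> and \<epsilon> :: real assume "0 < \<epsilon>"
  from tree_set_uniformly_continuous[OF this] obtain \<delta> where "0 < \<delta>"
    "\<And>\<sigma> \<tau>. code_tree_dist \<sigma> \<tau> < \<delta> \<Longrightarrow> hausdorff_dist (tree_set f \<sigma>) (tree_set f \<tau>) < \<epsilon>"
    by blast
  then show "\<exists>\<delta>>0. \<forall>\<tau>. \<tau> \<in> UNIV \<and> code_tree_dist \<sigma> \<tau> < \<delta> \<longrightarrow>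
      hausdorff_dist (tree_set f \<sigma>) (tree_set f \<tau>) < \<epsilon>"
    by (intro exI[of _ \<delta>]) simp
qed (auto simp: tree_set_nonempty_compacts)

section \<open>Transfer to tuples of compact sets\<close>

lemma Metric_space_set_tuples:
  "Metric_space (power_carrier nonempty_compacts) (max_dist hausdorff_dist :: ('v::finite \<Rightarrow> 'x set) \<Rightarrow> _)"
  by (rule Metric_space_power[OF Metric_space_hausdorff])

lemma continuous_tree_tuple:
  "continuous_map (Metric_space.mtopology UNIV (max_dist code_tree_dist))
    (Metric_space.mtopology (power_carrier nonempty_compacts) (max_dist hausdorff_dist))
    (tree_tuple f :: ('v::finite \<Rightarrow> _) \<Rightarrow> _)"
  unfolding Metric_space.metric_continuous_map[OF Metric_space_tree_tuples Metric_space_set_tuples]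
proof (intro conjI ballI allI impI)
  fix \<omega> :: "'v \<Rightarrow> ('m, 'n) code_tree" and \<epsilon> :: real assume "0 < \<epsilon>"
  \<comment> \<open>\<open>max_dist_le_iff\<close> handles only weak inequalities; halving
    \<epsilon> recovers the strict one.\<close>
  then have "0 < \<epsilon> / 2" by simp
  from tree_set_uniformly_continuous[OF this] obtain \<delta> where \<delta>: "0 < \<delta>"
    "\<And>\<sigma> \<tau>. code_tree_dist \<sigma> \<tau> < \<delta> \<Longrightarrow> hausdorff_dist (tree_set f \<sigma>) (tree_set f \<tau>) < \<epsilon> / 2"
    by blast
  show "\<exists>\<delta>>0. \<forall>\<kappa>. \<kappa> \<in> UNIV \<and> max_dist code_tree_dist \<omega> \<kappa> < \<delta> \<longrightarrow>
      max_dist hausdorff_dist (tree_tuple f \<omega>) (tree_tuple f \<kappa>) < \<epsilon>"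
  proof (intro exI[of _ \<delta>] conjI allI impI \<delta>(1))
    fix \<kappa> assume "\<kappa> \<in> UNIV \<and> max_dist code_tree_dist \<omega> \<kappa> < \<delta>"
    then have "code_tree_dist (\<omega> v) (\<kappa> v) < \<delta>" for v
      using max_dist_ge[of code_tree_dist \<omega> v \<kappa>] by simp
    then have "max_dist hausdorff_dist (tree_tuple f \<omega>) (tree_tuple f \<kappa>) \<le> \<epsilon> / 2"
      unfolding max_dist_le_iff tree_tuple_def using \<delta>(2) by (auto intro: less_imp_le)
    then show "max_dist hausdorff_dist (tree_tuple f \<omega>) (tree_tuple f \<kappa>) < \<epsilon>"
      using \<open>0 < \<epsilon>\<close> by linarith
  qed
qed (auto simp: power_carrier_def tree_tuple_def tree_set_nonempty_compacts)

lemma set_step_power_carrier: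
  "set_step f a \<in> power_carrier nonempty_compacts \<rightarrow> power_carrier nonempty_compacts"
  by (auto simp: power_carrier_def set_step_def intro!: UN_image_nonempty_compacts continuous)

lemma set_step_contraction:
  fixes K L :: "'v::finite \<Rightarrow> 'x set"
  assumes "K \<in> power_carrier nonempty_compacts" "L \<in> power_carrier nonempty_compacts"
  shows "max_dist hausdorff_dist (set_step f a K) (set_step f a L) \<le> l * max_dist hausdorff_dist K L"
  unfolding max_dist_le_iff set_step_def
  using assms by (intro allI hausdorff_dist_UN_image_le lipschitz max_dist_ge)
    (auto simp: power_carrier_def)

lemma max_dist_le_diam:
  fixes K L :: "'v::finite \<Rightarrow> 'x set"
  assumes "K \<in> power_carrier nonempty_compacts" "L \<in> power_carrier nonempty_compacts"
  shows "max_dist hausdorff_dist K L \<le> diam"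
  unfolding max_dist_le_iff
  using assms by (auto simp: power_carrier_def intro: hausdorff_dist_le_diam)

lemma continuous_set_step:
  fixes a :: "('v::finite, 'n, 'm) super_index"
  shows "continuous_map (Metric_space.mtopology (power_carrier nonempty_compacts) (max_dist hausdorff_dist))
    (Metric_space.mtopology (power_carrier nonempty_compacts) (max_dist hausdorff_dist)) (set_step f a)"
  by (rule Lipschitz_continuous_map_mtopology[OF Metric_space_set_tuples Metric_space_set_tuples
        set_step_power_carrier]) (rule set_step_contraction)

lemma super_attractor_eq:
  assumes "2 \<le> CARD('m)"
  shows "super_attractor f = tree_tuple f ` (tree_attractor :: ('v::finite \<Rightarrow> ('m, 'n) code_tree) set)"
proof -
  let ?T = "tree_attractor :: ('v \<Rightarrow> ('m, 'n) code_tree) set"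
  have T: "?T = (\<Union>a. tree_step a ` ?T)"
    unfolding tree_attractor_eq[OF assms] by (rule range_code_invariant)
  show ?thesis
    unfolding super_attractor_def
  proof (rule set_attractor_eqI[OF Metric_space_set_tuples _ _ _ l_nonneg l_less_1])
    show "tree_tuple f ` ?T \<noteq> {}" by (simp add: tree_attractor_eq[OF assms])
    show "compactin (Metric_space.mtopology (power_carrier nonempty_compacts) (max_dist hausdorff_dist))
        (tree_tuple f ` ?T)"
      unfolding tree_attractor_eq[OF assms]
      by (rule image_compactin[OF compactin_range_code[OF assms] continuous_tree_tuple])
    have "tree_tuple f ` ?T = tree_tuple f ` (\<Union>a. tree_step a ` ?T)" using T by simp
    also have "\<dots> = (\<Union>a. set_step f a ` tree_tuple f ` ?T)"
      by (simp add: image_UN image_image tree_tuple_tree_step)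
    finally show "tree_tuple f ` ?T = (\<Union>a. set_step f a ` tree_tuple f ` ?T)" .
  qed (rule set_step_contraction)
qed

lemma super_measure_eq:
  fixes p :: "('v::finite, 'n, 'm) super_index \<Rightarrow> real"
  assumes "2 \<le> CARD('m)" and p: "\<And>a. 0 \<le> p a" "(\<Sum>a\<in>UNIV. p a) = 1"
  shows "super_measure f p = distr (tree_measure p)
    (borel_on (power_carrier nonempty_compacts) (max_dist hausdorff_dist)) (tree_tuple f)"
  unfolding super_measure_def
proof (rule measure_attractor_eqI[OF Metric_space_set_tuples _ p(1) _ l_nonneg l_less_1])
  show "invariant_prob (power_carrier nonempty_compacts) (max_dist hausdorff_dist) (set_step f) p
      (distr (tree_measure p) (borel_on (power_carrier nonempty_compacts) (max_dist hausdorff_dist))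
        (tree_tuple f))"
    by (rule invariant_prob_distr[OF Metric_space_tree_tuples Metric_space_set_tuples
          invariant_prob_tree_measure[OF assms] continuous_tree_tuple continuous_tree_step
          continuous_set_step]) (rule tree_tuple_tree_step)
qed (rule max_dist_le_diam set_step_power_carrier set_step_contraction; assumption)+

end

text \<open>Coordinate projections are 1-Lipschitz for the maximum metric; this makes the marginals
  genuine push-forwards.\<close>

lemma continuous_map_component:
  fixes v :: "'v::finite"
  assumes "Metric_space S d"
  shows "continuous_map (Metric_space.mtopology (power_carrier S) (max_dist d))
    (Metric_space.mtopology S d) (\<lambda>x. x v)"
  by (rule Lipschitz_continuous_map_mtopology[OF Metric_space_power[OF assms] assms, where c = 1])
    (auto simp: power_carrier_def intro: max_dist_ge)

theorem theorem17:
  fixes f :: "'n::finite \<Rightarrow> 'm::finite \<Rightarrow> 'x::metric_space \<Rightarrow> 'x"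
    and l :: real
    and P :: "'n \<Rightarrow> real"
    and p :: "('v::finite, 'n, 'm) super_index \<Rightarrow> real"
    and first :: 'v
  assumes "compact (UNIV :: 'x set)"
    and "CARD('m) \<ge> 2"
    and "0 \<le> l" and "l < 1"
    and "\<And>n m. l-lipschitz_on UNIV (f n m)"
    and "\<And>n. P n > 0" and "(\<Sum>n\<in>UNIV. P n) = 1"
    and "\<And>a. p a \<ge> 0" and "(\<Sum>a\<in>UNIV. p a) = 1"
  shows "(\<forall>(a :: ('v, 'n, 'm) super_index) \<omega>.
            tree_tuple f (tree_step a \<omega>) = set_step f a (tree_tuple f \<omega>))
    \<and> tree_tuple f ` tree_attractor = (super_attractor f :: ('v \<Rightarrow> 'x set) set)
    \<and> tree_set f ` ((\<lambda>\<omega>. \<omega> first) ` tree_attractor) =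
        (\<lambda>K. K first) ` (super_attractor f :: ('v \<Rightarrow> 'x set) set)
    \<and> ((\<forall>a. p a = (\<Prod>v\<in>UNIV. P (fst (a v))) / real CARD('v) ^ (CARD('m) * CARD('v))) \<longrightarrow>
        distr (tree_measure p)
            (borel_on (power_carrier nonempty_compacts) (max_dist hausdorff_dist)) (tree_tuple f)
          = super_measure f p
        \<and> distr (distr (tree_measure p) (borel_on UNIV code_tree_dist) (\<lambda>\<omega>. \<omega> first))
            (borel_on nonempty_compacts hausdorff_dist) (tree_set f)
          = distr (super_measure f p) (borel_on nonempty_compacts hausdorff_dist) (\<lambda>K. K first))"
proof -
  interpret compact_lipschitz_maps f l by unfold_locales (fact assms)+
  note attr = super_attractor_eq[OF assms(2), where 'v = 'v]
  note meas = super_measure_eq[OF assms(2,8,9)]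
  have sets: "sets (tree_measure p) = sets (borel_on UNIV (max_dist code_tree_dist))"
    using invariant_prob_tree_measure[OF assms(2,8,9)] by (simp add: invariant_prob_def)
  have 1: "(\<lambda>\<omega>. \<omega> first) \<in> measurable (tree_measure p) (borel_on UNIV code_tree_dist)"
    using measurable_borel_on[OF Metric_space_tree_tuples Metric_space_code_tree _ sets]
      continuous_map_component[OF Metric_space_code_tree, of first] by simp
  have 2: "tree_set f \<in> measurable (borel_on UNIV code_tree_dist) (borel_on nonempty_compacts hausdorff_dist)"
    by (rule measurable_borel_on[OF Metric_space_code_tree Metric_space_hausdorff continuous_tree_set refl])
  have 3: "tree_tuple f \<in> measurable (tree_measure p)
      (borel_on (power_carrier nonempty_compacts) (max_dist hausdorff_dist))"
    by (rule measurable_borel_on[OF Metric_space_tree_tuples Metric_space_set_tuples continuous_tree_tuple sets])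
  have 4: "(\<lambda>K. K first) \<in> measurable (borel_on (power_carrier nonempty_compacts) (max_dist hausdorff_dist))
      (borel_on nonempty_compacts (hausdorff_dist :: 'x set \<Rightarrow> _))"
    by (rule measurable_borel_on[OF Metric_space_set_tuples Metric_space_hausdorff
          continuous_map_component[OF Metric_space_hausdorff] refl])
  \<comment> \<open>Both sides are the push-forward of \<open>tree_measure p\<close> under the map
    taking \<omega> to \<open>tree_set f (\<omega> first)\<close>; the four measurability facts
    permit composing the push-forwards.\<close>
  have "distr (distr (tree_measure p) (borel_on UNIV code_tree_dist) (\<lambda>\<omega>. \<omega> first))
        (borel_on nonempty_compacts hausdorff_dist) (tree_set f)
      = distr (super_measure f p) (borel_on nonempty_compacts hausdorff_dist) (\<lambda>K. K first)"
    unfolding meas distr_distr[OF 2 1] distr_distr[OF 4 3] by (simp add: tree_tuple_def comp_def)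
  moreover have "tree_set f ` (\<lambda>\<omega>. \<omega> first) ` tree_attractor =
      (\<lambda>K. K first) ` (super_attractor f :: ('v \<Rightarrow> 'x set) set)"
    by (simp add: attr image_image tree_tuple_def)
  ultimately show ?thesis
    by (intro conjI allI impI tree_tuple_tree_step attr[symmetric] meas[symmetric])
qed

end
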